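(* Let $K$ be a reduced commutative ring with $\frac12\in K$ and let $n\ge2$. Then: 1. The group $\Omega$ is a maximal abelian subgroup of $U$ if $n$ is even ($\Omega\supseteq U^n$). 2. The group $\Omega U^n=\Omega\times U^n$ is a maximal abelian subgroup of $U$ if $n$ is odd ($\Omega\cap U^n=\{e\}$).
   Context: $\Lambda_n=\Lambda_n(K)$ is the Grassmann $K$-algebra generated freely over $K$ by $x_1,\dots,x_n$ subject to $x_i^2=0$, $x_ix_j=-x_jx_i$ ($i\ne j$); it is graded by total degree with components $\Lambda_{n,d}$; $\mathfrak m=\bigoplus_{d\ge1}\Lambda_{n,d}$; $\Lambda_n^{od}$ is the sum of the odd degree components. A commutative ring is reduced if $0$ is its only nilpotent element. $G=\mathrm{Aut}_K(\Lambda_n)$ is the group of $K$-algebra automorphisms of $\Lambda_n$. $U=\{\sigma\in G\mid\sigma(x_i)-x_i\in\mathfrak m^2\text{ for all }i\}$; for $i\ge2$, $U^i=\{\sigma\in U\mid(\sigma-1)(\mathfrak m)\subseteq\mathfrak m^i\}$; in particular $U^n=\{\sigma\mid\sigma(x_i)=x_i+\lambda_ix_1\cdots x_n\text{ for all } i,\ (\lambda_1,\dots,\lambda_n)\in K^n\}$. $\Omega=\{\omega_{1+a}\mid a\in\Lambda_n^{od}\}$, where $\omega_u(x)=uxu^{-1}$ for a unit $u\in\Lambda_n$. *)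

theory Defs
  imports "HOL-Algebra.Coset" "HOL-Library.Cardinality"
begin

text \<open>
  The generators are indexed by a finite linearly ordered type \<open>'n\<close>, so that \<open>n = CARD('n)\<close>.
  The algebra is free as a \<open>'k\<close>-module on the monomials
  \<open>x\<^sub>S = x\<^bsub>i1\<^esub> \<cdots> x\<^bsub>ip\<^esub>\<close>, where \<open>S = {i1 < \<dots> < ip}\<close> is a set of indices, and an element is
  stored as its family of coordinates. That this is the algebra freely generated by
  the \<open>x\<^sub>i\<close> subject to the relations \<open>x\<^sub>i\<^sup>2 = 0\<close> and
  \<open>x\<^sub>i x\<^sub>j = - x\<^sub>j x\<^sub>i\<close> is the content of \<open>gvar_square\<close>, \<open>gvar_anticommute\<close> and
  \<open>grassmann_universal\<close> below.
\<close>

typedef ('k, 'n) grassmann = "UNIV :: ('n set \<Rightarrow> 'k) set"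
  morphisms gcoeff Grassmann ..

setup_lifting type_definition_grassmann

text \<open>For disjoint \<open>A\<close> and \<open>B\<close>, \<open>x\<^sub>A x\<^sub>B = merge_sign A B x\<^bsub>A \<union> B\<^esub>\<close>: the exponent is the number of
  transpositions of neighbouring generators needed to sort \<open>x\<^sub>A x\<^sub>B\<close>.\<close>

definition merge_sign :: "'n::linorder set \<Rightarrow> 'n set \<Rightarrow> 'a::ring_1" where
  "merge_sign A B = (- 1) ^ card {(a, b). a \<in> A \<and> b \<in> B \<and> b < a}"

lemma merge_sign_empty [simp]: "merge_sign {} B = 1" "merge_sign A {} = 1"
  by (simp_all add: merge_sign_def)

lemma merge_sign_Un_left:
  fixes A B C :: "'n::{finite,linorder} set"
  assumes "A \<inter> B = {}"
  shows "merge_sign (A \<union> B) C = merge_sign A C * (merge_sign B C :: 'a::ring_1)"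
proof -
  have "{(a, b). a \<in> A \<union> B \<and> b \<in> C \<and> b < a} =
        {(a, b). a \<in> A \<and> b \<in> C \<and> b < a} \<union> {(a, b). a \<in> B \<and> b \<in> C \<and> b < a}" by auto
  moreover have "{(a, b). a \<in> A \<and> b \<in> C \<and> b < a} \<inter> {(a, b). a \<in> B \<and> b \<in> C \<and> b < a} = {}"
    using assms by auto
  ultimately show ?thesis
    by (simp add: merge_sign_def card_Un_disjoint power_add)
qed

lemma merge_sign_Un_right:
  fixes A B C :: "'n::{finite,linorder} set"
  assumes "B \<inter> C = {}"
  shows "merge_sign A (B \<union> C) = merge_sign A B * (merge_sign A C :: 'a::ring_1)"
proof -
  have "{(a, b). a \<in> A \<and> b \<in> B \<union> C \<and> b < a} =
        {(a, b). a \<in> A \<and> b \<in> B \<and> b < a} \<union> {(a, b). a \<in> A \<and> b \<in> C \<and> b < a}" by auto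
  moreover have "{(a, b). a \<in> A \<and> b \<in> B \<and> b < a} \<inter> {(a, b). a \<in> A \<and> b \<in> C \<and> b < a} = {}"
    using assms by auto
  ultimately show ?thesis
    by (simp add: merge_sign_def card_Un_disjoint power_add)
qed

instantiation grassmann :: (comm_ring_1, "{finite,linorder}") ring_1
begin

lift_definition zero_grassmann :: "('a, 'b) grassmann" is "\<lambda>_. 0" .
lift_definition one_grassmann :: "('a, 'b) grassmann" is "\<lambda>S. if S = {} then 1 else 0" .
lift_definition plus_grassmann ::
  "('a, 'b) grassmann \<Rightarrow> ('a, 'b) grassmann \<Rightarrow> ('a, 'b) grassmann" is "\<lambda>f g S. f S + g S" .
lift_definition minus_grassmann ::
  "('a, 'b) grassmann \<Rightarrow> ('a, 'b) grassmann \<Rightarrow> ('a, 'b) grassmann" is "\<lambda>f g S. f S - g S" .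
lift_definition uminus_grassmann ::
  "('a, 'b) grassmann \<Rightarrow> ('a, 'b) grassmann" is "\<lambda>f S. - f S" .
lift_definition times_grassmann ::
  "('a, 'b) grassmann \<Rightarrow> ('a, 'b) grassmann \<Rightarrow> ('a, 'b) grassmann" is
  "\<lambda>f g S. \<Sum>A\<in>Pow S. merge_sign A (S - A) * f A * g (S - A)" .

instance
proof
  fix a b c :: "('a, 'b) grassmann"
  show "a + b + c = a + (b + c)" by transfer (simp add: add.assoc)
  show "a + b = b + a" by transfer (simp add: add.commute)
  show "0 + a = a" by transfer simp
  show "- a + a = 0" by transfer simp
  show "a - b = a + - b" by transfer simp
  show "(a + b) * c = a * c + b * c"
    by transfer (simp add: algebra_simps sum.distrib)
  show "a * (b + c) = a * b + a * c"
    by transfer (simp add: algebra_simps sum.distrib)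
  show "(0::('a, 'b) grassmann) \<noteq> 1" by transfer (auto dest: fun_cong[of _ _ "{}"])
  show "1 * a = a"
  proof (transfer, rule ext)
    fix f :: "'b set \<Rightarrow> 'a" and S
    have "(\<Sum>A\<in>Pow S. merge_sign A (S - A) * (if A = {} then 1 else 0) * f (S - A)) =
          (\<Sum>A\<in>Pow S. if A = {} then f S else 0)"
      by (rule sum.cong) auto
    then show "(\<Sum>A\<in>Pow S. merge_sign A (S - A) * (if A = {} then 1 else 0) * f (S - A)) = f S"
      by simp
  qed
  show "a * 1 = a"
  proof (transfer, rule ext)
    fix f :: "'b set \<Rightarrow> 'a" and S
    have "(\<Sum>A\<in>Pow S. merge_sign A (S - A) * f A * (if S - A = {} then 1 else 0)) =
          (\<Sum>A\<in>Pow S. if A = S then f S else 0)"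
      by (rule sum.cong) (auto simp: Diff_eq_empty_iff)
    then show "(\<Sum>A\<in>Pow S. merge_sign A (S - A) * f A * (if S - A = {} then 1 else 0)) = f S"
      by simp
  qed
  show "a * b * c = a * (b * c)"
  proof (transfer, rule ext)
    fix f g h :: "'b set \<Rightarrow> 'a" and S
    let ?s = "merge_sign :: 'b set \<Rightarrow> 'b set \<Rightarrow> 'a"
    have "(\<Sum>D\<in>Pow S. ?s D (S - D) * (\<Sum>A\<in>Pow D. ?s A (D - A) * f A * g (D - A)) * h (S - D)) =
          (\<Sum>(D, A)\<in>(SIGMA D:Pow S. Pow D).
             ?s D (S - D) * ?s A (D - A) * f A * g (D - A) * h (S - D))"
      by (subst sum.Sigma[symmetric])
         (auto simp: sum_distrib_left sum_distrib_right mult.assoc intro!: sum.cong)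
    also have "\<dots> = (\<Sum>(A, B)\<in>(SIGMA A:Pow S. Pow (S - A)).
             ?s A (S - A) * ?s B (S - A - B) * f A * g B * h (S - A - B))"
    proof (rule sum.reindex_bij_witness
        [where j = "\<lambda>(D, A). (A, D - A)" and i = "\<lambda>(A, B). (A \<union> B, A)"], goal_cases)
      case (5 p)
      then obtain D A where p: "p = (D, A)" "A \<subseteq> D" "D \<subseteq> S" by auto
      have D: "D = A \<union> (D - A)" and SA: "S - A = (D - A) \<union> (S - D)" using p by auto
      have "?s D (S - D) = ?s A (S - D) * ?s (D - A) (S - D)"
        by (subst D, subst merge_sign_Un_left) auto
      moreover have "?s A (S - A) = ?s A (D - A) * ?s A (S - D)"
        by (subst SA, subst merge_sign_Un_right) auto
      moreover have "S - A - (D - A) = S - D" using p by auto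
      ultimately show ?case by (simp add: p ac_simps)
    qed auto
    also have "\<dots> = (\<Sum>A\<in>Pow S. ?s A (S - A) * f A *
             (\<Sum>B\<in>Pow (S - A). ?s B (S - A - B) * g B * h (S - A - B)))"
      by (subst sum.Sigma[symmetric])
         (auto simp: sum_distrib_left ac_simps intro!: sum.cong)
    finally show "(\<Sum>D\<in>Pow S. ?s D (S - D) * (\<Sum>A\<in>Pow D. ?s A (D - A) * f A * g (D - A)) * h (S - D)) =
        (\<Sum>A\<in>Pow S. ?s A (S - A) * f A *
             (\<Sum>B\<in>Pow (S - A). ?s B (S - A - B) * g B * h (S - A - B)))" .
  qed
qed

end

lift_definition gscale :: "'k::comm_ring_1 \<Rightarrow> ('k, 'n::{finite,linorder}) grassmann \<Rightarrow> ('k, 'n) grassmann"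
  (infixr \<open>*g\<close> 75) is "\<lambda>c f S. c * f S" .

lift_definition gmono :: "'n::{finite,linorder} set \<Rightarrow> ('k::comm_ring_1, 'n) grassmann"
  is "\<lambda>T S. if S = T then 1 else 0" .

abbreviation gvar :: "'n::{finite,linorder} \<Rightarrow> ('k::comm_ring_1, 'n) grassmann" where
  "gvar i \<equiv> gmono {i}"

lemma gmono_empty: "gmono {} = 1"
  by transfer simp

lemma gmono_mult:
  fixes A B :: "'n::{finite,linorder} set"
  shows "(gmono A :: ('k::comm_ring_1, 'n) grassmann) * gmono B = (if A \<inter> B = {} then merge_sign A B *g gmono (A \<union> B) else 0)"
proof -
  have "gcoeff (gmono A * gmono B) S =
        gcoeff (if A \<inter> B = {} then merge_sign A B *g gmono (A \<union> B) else 0 :: ('k, 'n) grassmann) S" for S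
  proof -
    have "gcoeff (gmono A * gmono B) S =
          (\<Sum>C\<in>Pow S. if C = A then (if S - A = B then merge_sign A B else 0 :: 'k) else 0)"
      unfolding times_grassmann.rep_eq gmono.rep_eq by (rule sum.cong) auto
    also have "\<dots> = (if A \<subseteq> S \<and> S - A = B then merge_sign A B else 0)" by simp
    also have "A \<subseteq> S \<and> S - A = B \<longleftrightarrow> A \<inter> B = {} \<and> S = A \<union> B" by auto
    finally show ?thesis by (simp add: gscale.rep_eq gmono.rep_eq zero_grassmann.rep_eq)
  qed
  then show ?thesis by (simp add: gcoeff_inject[symmetric] fun_eq_iff)
qed

lemma gscale_simps:
  "(c * d) *g a = c *g d *g a" "(c + d) *g a = c *g a + d *g a" "c *g (a + b) = c *g a + c *g b"
  "1 *g a = a" "c *g a * b = c *g (a * b)" "a * c *g b = c *g (a * b)"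
  by (transfer; simp add: algebra_simps sum_distrib_left)+

lemma gvar_square: "gvar i * gvar i = 0"
  by (simp add: gmono_mult)

lemma gvar_anticommute:
  fixes i j :: "'n::{finite,linorder}"
  assumes "i \<noteq> j"
  shows "(gvar i :: ('k::comm_ring_1, 'n) grassmann) * gvar j = - (gvar j * gvar i)"
proof -
  have *: "{(a, b). a = i \<and> b = j \<and> b < a} = (if j < i then {(i, j)} else {})" for i j :: 'n
    by auto
  have "(- 1) *g a = - a" for a :: "('k, 'n) grassmann" by transfer simp
  with assms show ?thesis
    by (auto simp: gmono_mult merge_sign_def * insert_commute gscale_simps)
qed

lemma gcoeff_sum: "gcoeff (sum f A) S = (\<Sum>i\<in>A. gcoeff (f i) S)"
  by (induction A rule: infinite_finite_induct) (auto simp: zero_grassmann.rep_eq plus_grassmann.rep_eq)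

lemma grassmann_expand: "a = (\<Sum>S\<in>UNIV. gcoeff a S *g gmono S)"
  by (simp add: gcoeff_inject[symmetric] fun_eq_iff gcoeff_sum gscale.rep_eq gmono.rep_eq
        if_distrib[of "(*) _"] cong: if_cong)

lemma gmono_insert:
  fixes A :: "'n::{finite,linorder} set"
  assumes "\<forall>a\<in>A. i < a"
  shows "(gmono (insert i A) :: ('k::comm_ring_1, 'n) grassmann) = gvar i * gmono A"
proof -
  have "{(a, b). a \<in> {i} \<and> b \<in> A \<and> b < a} = {}" using assms by auto
  then have "merge_sign {i} A = (1::'k)" by (simp only: merge_sign_def card.empty power_0)
  moreover have "i \<notin> A" using assms by auto
  ultimately show ?thesis by (simp add: gmono_mult gscale_simps)
qed

context
  fixes \<iota> :: "'k::comm_ring_1 \<Rightarrow> 'a::ring_1" and y :: "'n::{finite,linorder} \<Rightarrow> 'a"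
  assumes \<iota>_one: "\<iota> 1 = 1" and \<iota>_add: "\<iota> (c + d) = \<iota> c + \<iota> d" and \<iota>_mult: "\<iota> (c * d) = \<iota> c * \<iota> d"
    and \<iota>_central: "\<iota> c * z = z * \<iota> c"
    and y_square: "y i * y i = 0"
    and y_anticommute: "i \<noteq> j \<Longrightarrow> y i * y j = - (y j * y i)"
begin

private definition ymono :: "'n set \<Rightarrow> 'a" where
  "ymono S = prod_list (map y (sorted_list_of_set S))"

private lemma ymono_empty: "ymono {} = 1"
  by (simp add: ymono_def)

private lemma ymono_insert:
  assumes "\<forall>a\<in>A. i < a"
  shows "ymono (insert i A) = y i * ymono A"
proof -
  have "i \<notin> A" using assms by auto
  then have "sorted_list_of_set (insert i A) = i # sorted_list_of_set A"
    using assms by (simp add: insort_is_Cons less_imp_le)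
  then show ?thesis by (simp add: ymono_def)
qed

private lemma y_ymono:
  "y i * ymono A = (if i \<in> A then 0 else (- 1) ^ card {a\<in>A. a < i} * ymono (insert i A))"
using finite[of A]
proof (induction A rule: finite_linorder_min_induct)
  case empty
  then show ?case using ymono_insert[of "{}" i] by simp
next
  case (insert b A)
  have ins: "ymono (insert b A) = y b * ymono A"
    using insert by (intro ymono_insert) auto
  consider "i = b" | "i < b" | "b < i" by force
  then show ?case
  proof cases
    case 1
    then have "y i * ymono (insert b A) = (y b * y b) * ymono A" by (simp only: ins mult.assoc)
    with 1 show ?thesis by (simp add: y_square)
  next
    case 2
    then have "\<forall>a\<in>insert b A. i < a" using insert by auto
    then have "{a\<in>insert b A. a < i} = {}" "i \<notin> insert b A"
      "ymono (insert i (insert b A)) = y i * ymono (insert b A)"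
      by (auto intro: ymono_insert)
    then show ?thesis by (simp only: card.empty power_0 if_False mult_1_left)
  next
    case 3
    let ?m = "card {a\<in>A. a < i}"
    have "y i * ymono (insert b A) = (y i * y b) * ymono A" by (simp only: ins mult.assoc)
    also have "y i * y b = - (y b * y i)" using 3 by (intro y_anticommute) auto
    finally have "y i * ymono (insert b A) = - (y b * (y i * ymono A))"
      by (simp only: mult.assoc minus_mult_left)
    also have "\<dots> = (if i \<in> A then 0 else - (y b * ((- 1) ^ ?m * ymono (insert i A))))"
      by (simp only: insert.IH if_distrib mult_zero_right minus_zero split: if_split) simp
    also have "y b * ((- 1) ^ ?m * ymono (insert i A)) = (- 1) ^ ?m * (y b * ymono (insert i A))"
      by (cases "even ?m") simp_all
    also have "y b * ymono (insert i A) = ymono (insert b (insert i A))"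
      using 3 insert.hyps by (intro ymono_insert[symmetric]) auto
    also have "insert b (insert i A) = insert i (insert b A)" by (rule insert_commute)
    finally have "y i * ymono (insert b A) =
      (if i \<in> A then 0 else - ((- 1) ^ ?m * ymono (insert i (insert b A))))" .
    moreover have "{a\<in>insert b A. a < i} = insert b {a\<in>A. a < i}" using 3 by auto
    then have "card {a\<in>insert b A. a < i} = Suc ?m" using insert.hyps by auto
    moreover have "i \<in> insert b A \<longleftrightarrow> i \<in> A" using 3 by auto
    ultimately show ?thesis by (simp only: power_Suc mult_minus1 minus_mult_left)
  qed
qed

private lemma ymono_mult:
  "ymono A * ymono B = (if A \<inter> B = {} then merge_sign A B * ymono (A \<union> B) else 0)"
using finite[of A]
proof (induction A rule: finite_linorder_min_induct)
  case empty
  then show ?case by (simp add: ymono_empty)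
next
  case (insert i A)
  have i: "i \<notin> A" using insert by auto
  have eq: "ymono (insert i A) * ymono B = y i * (ymono A * ymono B)"
    using insert by (simp add: ymono_insert mult.assoc)
  show ?case
  proof (cases "A \<inter> B = {}")
    case False
    then show ?thesis using insert eq by auto
  next
    case True
    have *: "{(a, b). a = i \<and> b \<in> B \<and> b < a} = Pair i ` {b\<in>B. b < i}" by auto
    have card: "card {(a, b). a = i \<and> b \<in> B \<and> b < a} = card {b\<in>B. b < i}"
      unfolding * by (rule card_image) (auto simp: inj_on_def)
    have lt: "{b. (b \<in> A \<or> b \<in> B) \<and> b < i} = {b\<in>B. b < i}" using insert by auto
    have "merge_sign (insert i A) B = merge_sign {i} B * (merge_sign A B :: 'a)"
      using merge_sign_Un_left[of "{i}" A B] i by simp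
    also have "merge_sign {i} B = ((- 1) ^ card {b\<in>B. b < i} :: 'a)"
      by (simp add: merge_sign_def card)
    finally have ms: "merge_sign (insert i A) B = ((- 1) ^ card {b\<in>B. b < i} * merge_sign A B :: 'a)" .
    have comm: "y i * (merge_sign A B * z) = merge_sign A B * (y i * z)" for z
      unfolding merge_sign_def by (cases "even (card {(a, b). a \<in> A \<and> b \<in> B \<and> b < a})") auto
    have comm2: "merge_sign A B * ((- 1) ^ m * z) = (- 1) ^ m * (merge_sign A B * z)" for m and z :: 'a
      by (cases "even m") auto
    show ?thesis using insert.IH True eq i
      by (auto simp: comm y_ymono lt ms comm2 mult.assoc)
  qed
qed

private lemma \<iota>_zero: "\<iota> 0 = 0"
  using \<iota>_add[of 0 0] by simp

private lemma \<iota>_uminus: "\<iota> (- c) = - \<iota> c"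
  using \<iota>_add[of "- c" c] by (simp add: \<iota>_zero eq_neg_iff_add_eq_0)

private lemma \<iota>_sum: "\<iota> (sum f A) = (\<Sum>i\<in>A. \<iota> (f i))"
  by (induction A rule: infinite_finite_induct) (auto simp: \<iota>_zero \<iota>_add)

private lemma \<iota>_merge_sign: "\<iota> (merge_sign A B) = merge_sign A B"
proof -
  have "\<iota> ((- 1) ^ m) = (- 1) ^ m" for m
    by (induction m) (auto simp: \<iota>_one \<iota>_mult \<iota>_uminus)
  then show ?thesis by (simp add: merge_sign_def)
qed

text \<open>A \<open>'k\<close>-algebra is a ring \<open>'a\<close> with a ring homomorphism \<open>\<iota>\<close> from \<open>'k\<close> to its centre.\<close>

lemma grassmann_universal:
  "\<exists>!\<phi> :: ('k, 'n) grassmann \<Rightarrow> 'a.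
     (\<forall>a b. \<phi> (a + b) = \<phi> a + \<phi> b) \<and> (\<forall>a b. \<phi> (a * b) = \<phi> a * \<phi> b) \<and> \<phi> 1 = 1 \<and>
     (\<forall>c a. \<phi> (c *g a) = \<iota> c * \<phi> a) \<and> (\<forall>i. \<phi> (gvar i) = y i)"
proof (rule ex_ex1I)
  define \<phi> :: "('k, 'n) grassmann \<Rightarrow> 'a" where "\<phi> a = (\<Sum>S\<in>UNIV. \<iota> (gcoeff a S) * ymono S)" for a
  have "\<phi> (a + b) = \<phi> a + \<phi> b" for a b
    by (simp add: \<phi>_def plus_grassmann.rep_eq \<iota>_add algebra_simps sum.distrib)
  moreover have scale: "\<phi> (c *g a) = \<iota> c * \<phi> a" for c a
    by (simp add: \<phi>_def gscale.rep_eq \<iota>_mult mult.assoc sum_distrib_left)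
  moreover have mono: "\<phi> (gmono S) = ymono S" for S
    by (simp add: \<phi>_def gmono.rep_eq if_distrib[of \<iota>] \<iota>_one \<iota>_zero if_distribR
        if_distrib[of "\<lambda>x. x * _"] cong: if_cong)
  moreover have "\<phi> (a * b) = \<phi> a * \<phi> b" for a b
  proof -
    let ?t = "\<lambda>A B. \<iota> (gcoeff a A) * \<iota> (gcoeff b B) * (ymono A * ymono B)"
    have "\<phi> (a * b) = (\<Sum>S\<in>UNIV. \<Sum>A\<in>Pow S. ?t A (S - A))"
      unfolding \<phi>_def
    proof (rule sum.cong[OF refl])
      fix S
      have "\<iota> (merge_sign A (S - A) * gcoeff a A * gcoeff b (S - A)) * ymono S = ?t A (S - A)"
        if "A \<in> Pow S" for A
      proof -
        have "A \<union> (S - A) = S" using that by auto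
        then have "?t A (S - A) = \<iota> (gcoeff a A) * \<iota> (gcoeff b (S - A)) * (\<iota> (merge_sign A (S - A)) * ymono S)"
          by (simp add: ymono_mult \<iota>_merge_sign)
        also have "\<dots> = \<iota> (gcoeff a A * gcoeff b (S - A) * merge_sign A (S - A)) * ymono S"
          by (simp add: \<iota>_mult mult.assoc)
        finally show ?thesis by (simp add: ac_simps)
      qed
      then show "\<iota> (gcoeff (a * b) S) * ymono S = (\<Sum>A\<in>Pow S. ?t A (S - A))"
        by (simp add: times_grassmann.rep_eq \<iota>_sum sum_distrib_right)
    qed
    also have "\<dots> = (\<Sum>(S, A)\<in>(SIGMA S:UNIV. Pow S). ?t A (S - A))"
      by (rule sum.Sigma) auto
    also have "\<dots> = (\<Sum>(A, B)\<in>{(A, B). A \<inter> B = {}}. ?t A B)"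
      by (rule sum.reindex_bij_witness
          [where j = "\<lambda>(S, A). (A, S - A)" and i = "\<lambda>(A, B). (A \<union> B, A)"]) auto
    also have "\<dots> = (\<Sum>(A, B)\<in>UNIV \<times> UNIV. ?t A B)"
      by (rule sum.mono_neutral_left) (simp_all add: ymono_mult split_beta)
    also have "\<dots> = (\<Sum>A\<in>UNIV. \<Sum>B\<in>UNIV. ?t A B)"
      by (rule sum.Sigma[symmetric]) auto
    also have "\<dots> = \<phi> a * \<phi> b"
      unfolding \<phi>_def sum_product
    proof (intro sum.cong refl)
      fix A B
      have "\<iota> (gcoeff b B) * (ymono A * ymono B) = ymono A * (\<iota> (gcoeff b B) * ymono B)"
        using \<iota>_central[of "gcoeff b B" "ymono A"] by (metis mult.assoc)
      then show "?t A B = \<iota> (gcoeff a A) * ymono A * (\<iota> (gcoeff b B) * ymono B)"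
        by (simp add: mult.assoc)
    qed
    finally show ?thesis .
  qed
  moreover have "\<phi> 1 = 1" using mono[of "{}"] by (simp add: gmono_empty ymono_empty)
  moreover have "\<phi> (gvar i) = y i" for i
    using ymono_insert[of "{}" i] by (simp add: mono ymono_empty)
  ultimately show "\<exists>\<phi> :: ('k, 'n) grassmann \<Rightarrow> 'a.
     (\<forall>a b. \<phi> (a + b) = \<phi> a + \<phi> b) \<and> (\<forall>a b. \<phi> (a * b) = \<phi> a * \<phi> b) \<and> \<phi> 1 = 1 \<and>
     (\<forall>c a. \<phi> (c *g a) = \<iota> c * \<phi> a) \<and> (\<forall>i. \<phi> (gvar i) = y i)"
    by (intro exI[of _ \<phi>]) simp
next
  have formula: "\<psi> = (\<lambda>a. \<Sum>S\<in>UNIV. \<iota> (gcoeff a S) * ymono S)"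
    if "(\<forall>a b. \<psi> (a + b) = \<psi> a + \<psi> b) \<and> (\<forall>a b. \<psi> (a * b) = \<psi> a * \<psi> b) \<and> \<psi> 1 = 1 \<and>
      (\<forall>c a. \<psi> (c *g a) = \<iota> c * \<psi> a) \<and> (\<forall>i. \<psi> (gvar i) = y i)"
    for \<psi> :: "('k, 'n) grassmann \<Rightarrow> 'a"
  proof
    fix a
    have mono: "\<psi> (gmono S) = ymono S" for S
      using finite[of S]
    proof (induction S rule: finite_linorder_min_induct)
      case (insert i A)
      then have "gmono (insert i A) = (gvar i * gmono A :: ('k, 'n) grassmann)"
        "ymono (insert i A) = y i * ymono A"
        by (intro gmono_insert ymono_insert; simp)+
      with insert that show ?case by (simp only:)
    qed (use that in \<open>auto simp: gmono_empty ymono_empty\<close>)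
    have "\<psi> 0 + \<psi> 0 = \<psi> 0" using that by (metis add_0)
    then have zero: "\<psi> 0 = 0" by simp
    have sum: "\<psi> (sum f A) = (\<Sum>i\<in>A. \<psi> (f i))" for f and A :: "'n set set"
      by (induction A rule: infinite_finite_induct) (use that zero in auto)
    have "\<psi> a = \<psi> (\<Sum>S\<in>UNIV. gcoeff a S *g gmono S)"
      by (rule arg_cong[OF grassmann_expand])
    also have "\<dots> = (\<Sum>S\<in>UNIV. \<iota> (gcoeff a S) * ymono S)"
      using that by (simp add: sum mono)
    finally show "\<psi> a = (\<Sum>S\<in>UNIV. \<iota> (gcoeff a S) * ymono S)" .
  qed
  show "\<phi> = \<psi>"
    if "(\<forall>a b. \<phi> (a + b) = \<phi> a + \<phi> b) \<and> (\<forall>a b. \<phi> (a * b) = \<phi> a * \<phi> b) \<and> \<phi> 1 = 1 \<and>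
        (\<forall>c a. \<phi> (c *g a) = \<iota> c * \<phi> a) \<and> (\<forall>i. \<phi> (gvar i) = y i)"
      "(\<forall>a b. \<psi> (a + b) = \<psi> a + \<psi> b) \<and> (\<forall>a b. \<psi> (a * b) = \<psi> a * \<psi> b) \<and> \<psi> 1 = 1 \<and>
        (\<forall>c a. \<psi> (c *g a) = \<iota> c * \<psi> a) \<and> (\<forall>i. \<psi> (gvar i) = y i)"
    for \<phi> \<psi> :: "('k, 'n) grassmann \<Rightarrow> 'a"
    using formula[OF that(1)] formula[OF that(2)] by simp
qed

end

text \<open>\<open>graded_part D\<close> is the sum of the homogeneous components of degree \<open>d \<in> D\<close>, where \<open>x\<^sub>S\<close> has
  degree \<open>card S\<close>.\<close>

definition graded_part :: "nat set \<Rightarrow> ('k::comm_ring_1, 'n::{finite,linorder}) grassmann set" where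
  "graded_part D = {a. \<forall>S. gcoeff a S \<noteq> 0 \<longrightarrow> card S \<in> D}"

definition aug_ideal :: "('k::comm_ring_1, 'n::{finite,linorder}) grassmann set" (\<open>\<mm>\<close>) where
  "\<mm> = graded_part {1..}"

definition odd_part :: "('k::comm_ring_1, 'n::{finite,linorder}) grassmann set" where
  "odd_part = graded_part {d. odd d}"

text \<open>The product of ideals, defined as \<open>ideal_prod\<close> in the theory \<open>HOL-Algebra.Ideal_Product\<close>.\<close>

inductive_set ideal_mult :: "'a::ring_1 set \<Rightarrow> 'a set \<Rightarrow> 'a set" for I J where
  prod: "a \<in> I \<Longrightarrow> b \<in> J \<Longrightarrow> a * b \<in> ideal_mult I J"
| sum: "s \<in> ideal_mult I J \<Longrightarrow> t \<in> ideal_mult I J \<Longrightarrow> s + t \<in> ideal_mult I J"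

primrec ideal_power :: "'a::ring_1 set \<Rightarrow> nat \<Rightarrow> 'a set" where
  "ideal_power I 0 = UNIV"
| "ideal_power I (Suc i) = ideal_mult I (ideal_power I i)"

definition alg_aut :: "(('k::comm_ring_1, 'n::{finite,linorder}) grassmann \<Rightarrow> ('k, 'n) grassmann) set" where
  "alg_aut = {\<sigma>. bij \<sigma> \<and> (\<forall>a b. \<sigma> (a + b) = \<sigma> a + \<sigma> b) \<and> (\<forall>a b. \<sigma> (a * b) = \<sigma> a * \<sigma> b) \<and>
     \<sigma> 1 = 1 \<and> (\<forall>c a. \<sigma> (c *g a) = c *g \<sigma> a)}"

definition aut_group :: "(('k::comm_ring_1, 'n::{finite,linorder}) grassmann \<Rightarrow> ('k, 'n) grassmann) monoid" where
  "aut_group = \<lparr>carrier = alg_aut, mult = (\<circ>), one = id\<rparr>"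

definition U_set :: "(('k::comm_ring_1, 'n::{finite,linorder}) grassmann \<Rightarrow> ('k, 'n) grassmann) set" where
  "U_set = {\<sigma> \<in> alg_aut. \<forall>i. \<sigma> (gvar i) - gvar i \<in> ideal_power \<mm> 2}"

definition U_group :: "(('k::comm_ring_1, 'n::{finite,linorder}) grassmann \<Rightarrow> ('k, 'n) grassmann) monoid" where
  "U_group = aut_group\<lparr>carrier := U_set\<rparr>"

definition U_pow :: "nat \<Rightarrow> (('k::comm_ring_1, 'n::{finite,linorder}) grassmann \<Rightarrow> ('k, 'n) grassmann) set" where
  "U_pow i = {\<sigma> \<in> U_set. \<forall>a\<in>\<mm>. \<sigma> a - a \<in> ideal_power \<mm> i}"

definition unit_inv :: "'a::ring_1 \<Rightarrow> 'a" where
  "unit_inv u = (THE v. u * v = 1 \<and> v * u = 1)"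

lemma unit_inv_eq:
  assumes "u * v = 1" "v * u = 1"
  shows "unit_inv u = v"
  unfolding unit_inv_def
proof (rule the_equality)
  show "w = v" if "u * w = 1 \<and> w * u = 1" for w
    using assms that by (metis mult.assoc mult_1_left mult_1_right)
qed (use assms in simp)

definition conj_by :: "'a::ring_1 \<Rightarrow> 'a \<Rightarrow> 'a" where
  "conj_by u x = u * x * unit_inv u"

definition Omega :: "(('k::comm_ring_1, 'n::{finite,linorder}) grassmann \<Rightarrow> ('k, 'n) grassmann) set" (\<open>\<Omega>\<close>) where
  "\<Omega> = {conj_by (1 + a) |a. a \<in> odd_part}"

lemma group_aut_group: "group (aut_group :: (('k::comm_ring_1, 'n::{finite,linorder}) grassmann \<Rightarrow> _) monoid)"
proof (rule groupI)
  show "\<exists>\<tau>\<in>carrier aut_group. \<tau> \<otimes>\<^bsub>aut_group\<^esub> \<sigma> = \<one>\<^bsub>aut_group\<^esub>"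
    if "\<sigma> \<in> carrier aut_group" for \<sigma> :: "('k, 'n) grassmann \<Rightarrow> _"
  proof
    have \<sigma>: "bij \<sigma>" "inj \<sigma>" "\<And>x. \<sigma> (inv_into UNIV \<sigma> x) = x" "\<sigma> 1 = 1"
      "\<And>a b. \<sigma> (a + b) = \<sigma> a + \<sigma> b" "\<And>a b. \<sigma> (a * b) = \<sigma> a * \<sigma> b" "\<And>c a. \<sigma> (c *g a) = c *g \<sigma> a"
      using that by (auto simp: aut_group_def alg_aut_def bij_is_inj bij_is_surj surj_f_inv_f)
    have "inv_into UNIV \<sigma> (a + b) = inv_into UNIV \<sigma> a + inv_into UNIV \<sigma> b" "inv_into UNIV \<sigma> (a * b) = inv_into UNIV \<sigma> a * inv_into UNIV \<sigma> b"
      "inv_into UNIV \<sigma> (c *g a) = c *g inv_into UNIV \<sigma> a" "inv_into UNIV \<sigma> 1 = 1" for a b c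
      by (rule inv_f_eq[OF \<sigma>(2)], simp add: \<sigma>)+
    then show "inv_into UNIV \<sigma> \<in> carrier aut_group"
      using \<sigma>(1) by (simp add: aut_group_def alg_aut_def bij_imp_bij_inv)
    show "inv_into UNIV \<sigma> \<otimes>\<^bsub>aut_group\<^esub> \<sigma> = \<one>\<^bsub>aut_group\<^esub>"
      using \<sigma>(2) by (simp add: aut_group_def)
  qed
qed (auto simp: aut_group_def alg_aut_def bij_comp comp_assoc)

lemma aug_ideal_iff: "a \<in> \<mm> \<longleftrightarrow> gcoeff a {} = 0"
  by (auto simp: aug_ideal_def graded_part_def Suc_le_eq card_gt_0_iff)

lemma ideal_power_two_aug_subset: "ideal_power \<mm> 2 \<subseteq> \<mm>"
proof
  show "a \<in> \<mm>" if "a \<in> ideal_power \<mm> 2" for a :: "('k::comm_ring_1, 'n::{finite,linorder}) grassmann"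
    using that unfolding numeral_2_eq_2 ideal_power.simps
    by induction (auto simp: aug_ideal_iff times_grassmann.rep_eq plus_grassmann.rep_eq)
qed

lemma uminus_ideal_power_two:
  assumes "a \<in> ideal_power \<mm> 2"
  shows "- a \<in> ideal_power \<mm> 2"
  using assms unfolding numeral_2_eq_2 ideal_power.simps
proof induction
  case (prod a b)
  then have "(- a) * b \<in> ideal_mult \<mm> (ideal_mult \<mm> UNIV)"
    by (intro ideal_mult.prod) (auto simp: aug_ideal_iff uminus_grassmann.rep_eq)
  then show ?case by simp
next
  case (sum s t)
  then have "- s + - t \<in> ideal_mult \<mm> (ideal_mult \<mm> UNIV)" by (intro ideal_mult.sum)
  then show ?case by simp
qed

lemma aut_ideal_power_two:
  assumes "\<sigma> \<in> alg_aut" "\<And>a. a \<in> \<mm> \<Longrightarrow> \<sigma> a \<in> \<mm>" "a \<in> ideal_power \<mm> 2"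
  shows "\<sigma> a \<in> ideal_power \<mm> 2"
proof -
  have 1: "\<sigma> b \<in> ideal_mult \<mm> UNIV" if "b \<in> ideal_mult \<mm> UNIV" for b
    using that by induction (use assms(1,2) in \<open>auto simp: alg_aut_def intro: ideal_mult.intros\<close>)
  show ?thesis using assms(3) unfolding numeral_2_eq_2 ideal_power.simps
    by induction (use assms(1,2) 1 in \<open>auto simp: alg_aut_def intro: ideal_mult.intros\<close>)
qed

lemma U_set_aug:
  assumes "\<sigma> \<in> U_set" "a \<in> \<mm>"
  shows "\<sigma> a \<in> \<mm>"
proof -
  have \<sigma>: "\<sigma> (a + b) = \<sigma> a + \<sigma> b" "\<sigma> (a * b) = \<sigma> a * \<sigma> b" "\<sigma> (c *g a) = c *g \<sigma> a" for a b c
    using assms(1) by (auto simp: U_set_def alg_aut_def)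
  have zero: "\<sigma> 0 = 0" using \<sigma>(1)[of 0 0] by simp
  have "\<sigma> (gvar i) \<in> \<mm>" for i
    using assms(1) ideal_power_two_aug_subset
    by (auto simp: U_set_def aug_ideal_iff minus_grassmann.rep_eq gmono.rep_eq subset_iff)
  then have var: "gcoeff (\<sigma> (gvar i)) {} = 0" for i by (simp add: aug_ideal_iff)
  have mono: "gcoeff (\<sigma> (gmono S)) {} = 0" if "S \<noteq> {}" for S
  proof -
    have "\<forall>a\<in>S - {Min S}. Min S < a" by (metis Diff_iff Min_le finite order_le_less singletonI)
    then have "gmono S = gvar (Min S) * (gmono (S - {Min S}) :: ('a, 'b) grassmann)"
      using gmono_insert[of "S - {Min S}" "Min S"] that by (simp add: insert_absorb)
    then show ?thesis by (simp add: \<sigma> times_grassmann.rep_eq var)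
  qed
  have sum: "\<sigma> (sum f A) = (\<Sum>i\<in>A. \<sigma> (f i))" for f and A :: "'b set set"
    by (induction A rule: infinite_finite_induct) (auto simp: \<sigma> zero)
  have "\<sigma> a = \<sigma> (\<Sum>S\<in>UNIV. gcoeff a S *g gmono S)"
    by (rule arg_cong[OF grassmann_expand])
  also have "\<dots> = (\<Sum>S\<in>UNIV. gcoeff a S *g \<sigma> (gmono S))" by (simp add: sum \<sigma>)
  finally have *: "\<sigma> a = (\<Sum>S\<in>UNIV. gcoeff a S *g \<sigma> (gmono S))" .
  have "gcoeff (\<sigma> a) {} = (\<Sum>S\<in>UNIV. gcoeff a S * gcoeff (\<sigma> (gmono S)) {})"
    by (subst *) (simp add: gcoeff_sum gscale.rep_eq)
  also have "\<dots> = 0"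
  proof (rule sum.neutral, rule ballI)
    show "gcoeff a S * gcoeff (\<sigma> (gmono S)) {} = 0" for S
      using assms(2) mono[of S] by (cases "S = {}") (auto simp: aug_ideal_iff)
  qed
  finally show ?thesis by (simp add: aug_ideal_iff)
qed

lemma subgroup_U_set:
  "subgroup (U_set :: (('k::comm_ring_1, 'n::{finite,linorder}) grassmann \<Rightarrow> _) set) aut_group"
proof (rule group.subgroupI[OF group_aut_group])
  show "U_set \<subseteq> carrier (aut_group :: (('k, 'n) grassmann \<Rightarrow> _) monoid)"
    by (auto simp: U_set_def aut_group_def)
  have "0 * 0 \<in> ideal_power (\<mm> :: ('k, 'n) grassmann set) 2"
    unfolding numeral_2_eq_2 ideal_power.simps
    by (intro ideal_mult.prod ideal_mult.prod[of 0 _ 0, simplified])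
       (auto simp: aug_ideal_iff zero_grassmann.rep_eq)
  then have "id \<in> (U_set :: (('k, 'n) grassmann \<Rightarrow> _) set)"
    by (simp add: U_set_def alg_aut_def)
  then show "(U_set :: (('k, 'n) grassmann \<Rightarrow> _) set) \<noteq> {}" by auto
next
  fix \<sigma> \<tau> :: "('k, 'n) grassmann \<Rightarrow> ('k, 'n) grassmann"
  assume U: "\<sigma> \<in> U_set" "\<tau> \<in> U_set"
  have aut: "\<sigma> \<in> alg_aut" "\<tau> \<in> alg_aut" using U by (auto simp: U_set_def)
  have add: "\<sigma> (a + b) = \<sigma> a + \<sigma> b" for a b using aut by (simp add: alg_aut_def)
  have "(\<sigma> \<circ> \<tau>) (gvar i) - gvar i \<in> ideal_power \<mm> 2" for i
  proof -
    have "\<sigma> (\<tau> (gvar i) - gvar i) \<in> ideal_power \<mm> 2"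
      by (rule aut_ideal_power_two[OF aut(1) U_set_aug[OF U(1)]]) (use U in \<open>auto simp: U_set_def\<close>)
    moreover have "\<sigma> (gvar i) - gvar i \<in> ideal_power \<mm> 2"
      using U by (auto simp: U_set_def)
    ultimately have "\<sigma> (\<tau> (gvar i) - gvar i) + (\<sigma> (gvar i) - gvar i) \<in> ideal_power \<mm> 2"
      unfolding numeral_2_eq_2 ideal_power.simps by (rule ideal_mult.sum)
    moreover have "\<sigma> (\<tau> (gvar i)) = \<sigma> (\<tau> (gvar i) - gvar i) + \<sigma> (gvar i)"
      by (simp add: add[symmetric])
    ultimately show ?thesis by (simp add: add_diff_eq)
  qed
  moreover have "\<sigma> \<circ> \<tau> \<in> alg_aut"
    using aut by (auto simp: alg_aut_def bij_comp)
  ultimately show "\<sigma> \<otimes>\<^bsub>aut_group\<^esub> \<tau> \<in> U_set" by (simp add: U_set_def aut_group_def)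
next
  fix \<sigma> :: "('k, 'n) grassmann \<Rightarrow> ('k, 'n) grassmann"
  assume U: "\<sigma> \<in> U_set"
  let ?\<tau> = "inv\<^bsub>aut_group\<^esub> \<sigma>"
  have carrier: "\<sigma> \<in> carrier aut_group" using U by (auto simp: U_set_def aut_group_def)
  have aut: "?\<tau> \<in> alg_aut"
    using group.inv_closed[OF group_aut_group carrier] by (simp add: aut_group_def)
  have "?\<tau> \<circ> \<sigma> = id" "\<sigma> \<circ> ?\<tau> = id"
    using group.l_inv[OF group_aut_group carrier] group.r_inv[OF group_aut_group carrier]
    by (auto simp: aut_group_def)
  then have inverse: "?\<tau> (\<sigma> a) = a" "\<sigma> (?\<tau> a) = a" for a by (simp_all add: fun_eq_iff)
  have \<sigma>: "\<sigma> (a + b) = \<sigma> a + \<sigma> b" "\<sigma> (c *g a) = c *g \<sigma> a" "\<sigma> 1 = 1" for a b c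
    using U by (auto simp: U_set_def alg_aut_def)
  have \<tau>: "?\<tau> (a + b) = ?\<tau> a + ?\<tau> b" for a b using aut by (simp add: alg_aut_def)
  have aug: "?\<tau> a \<in> \<mm>" if "a \<in> \<mm>" for a
  proof -
    let ?c = "gcoeff (?\<tau> a) {}"
    have "?\<tau> a - ?c *g 1 \<in> \<mm>"
      by (simp add: aug_ideal_iff minus_grassmann.rep_eq gscale.rep_eq one_grassmann.rep_eq)
    then have "\<sigma> (?\<tau> a - ?c *g 1) \<in> \<mm>" by (rule U_set_aug[OF U])
    moreover have "a = \<sigma> (?\<tau> a - ?c *g 1) + ?c *g 1"
      using \<sigma>(1)[of "?\<tau> a - ?c *g 1" "?c *g 1"] by (simp add: \<sigma>(2,3) inverse)
    then have "gcoeff a {} = gcoeff (\<sigma> (?\<tau> a - ?c *g 1)) {} + ?c"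
      by (metis gscale.rep_eq one_grassmann.rep_eq plus_grassmann.rep_eq mult_1_right)
    ultimately show ?thesis using that by (simp add: aug_ideal_iff)
  qed
  have "?\<tau> (gvar i) - gvar i \<in> ideal_power \<mm> 2" for i
  proof -
    have "?\<tau> (- (\<sigma> (gvar i) - gvar i)) \<in> ideal_power \<mm> 2"
      by (rule aut_ideal_power_two[OF aut aug uminus_ideal_power_two])
         (use U in \<open>auto simp: U_set_def\<close>)
    moreover have "?\<tau> (gvar i - \<sigma> (gvar i)) + ?\<tau> (\<sigma> (gvar i)) = ?\<tau> (gvar i)"
      by (subst \<tau>[symmetric]) simp
    then have "?\<tau> (gvar i - \<sigma> (gvar i)) = ?\<tau> (gvar i) - gvar i"
      by (simp add: inverse eq_diff_eq)
    ultimately show ?thesis by simp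
  qed
  with aut show "?\<tau> \<in> U_set" by (simp add: U_set_def)
qed

lemma group_U_group: "group (U_group :: (('k::comm_ring_1, 'n::{finite,linorder}) grassmann \<Rightarrow> _) monoid)"
  unfolding U_group_def by (rule subgroup.subgroup_is_group[OF subgroup_U_set group_aut_group])

definition abelian_subgroup :: "'a set \<Rightarrow> ('a, 'b) monoid_scheme \<Rightarrow> bool" where
  "abelian_subgroup H G \<longleftrightarrow> subgroup H G \<and> comm_group (G\<lparr>carrier := H\<rparr>)"

definition maximal_abelian_subgroup :: "'a set \<Rightarrow> ('a, 'b) monoid_scheme \<Rightarrow> bool" where
  "maximal_abelian_subgroup H G \<longleftrightarrow>
     abelian_subgroup H G \<and> (\<forall>H'. abelian_subgroup H' G \<and> H \<subseteq> H' \<longrightarrow> H' = H)"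

text \<open>The product set \<open>HL\<close> is the internal direct product of the subgroups \<open>H\<close> and \<open>L\<close> of \<open>G\<close>.\<close>

definition internal_direct_product :: "'a set \<Rightarrow> 'a set \<Rightarrow> ('a, 'b) monoid_scheme \<Rightarrow> bool" where
  "internal_direct_product H L G \<longleftrightarrow> subgroup H G \<and> subgroup L G \<and> subgroup (H <#>\<^bsub>G\<^esub> L) G \<and>
     (\<lambda>(h, l). h \<otimes>\<^bsub>G\<^esub> l) \<in>
       iso (G\<lparr>carrier := H\<rparr> \<times>\<times> G\<lparr>carrier := L\<rparr>) (G\<lparr>carrier := H <#>\<^bsub>G\<^esub> L\<rparr>)"

end

theory Submission
  imports Defs
begin

text \<open>
  For odd \<open>a\<close> the automorphism \<open>\<omega>\<^bsub>1 + a\<^esub>\<close> fixes the even elements and sends an odd \<open>x\<close> to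
  \<open>x + 2 a x\<close>; hence \<open>a \<mapsto> \<omega>\<^bsub>1 + a\<^esub>\<close> is additive and \<open>\<Omega>\<close> is abelian, and it commutes with
  \<open>U\<^sup>n\<close> because \<open>x\<^sub>1 \<cdots> x\<^sub>n\<close> is annihilated by \<open>\<mm>\<close>. Everything else rests on the fact that
  the centralizer of \<open>\<Omega>\<close> in \<open>U\<close> is \<open>\<Omega> U\<^sup>n\<close>: if \<open>\<sigma>\<close> commutes with \<open>\<Omega>\<close>, then the odd part of
  \<open>\<sigma> x\<^sub>i\<close> differs from \<open>x\<^sub>i\<close> only in degree \<open>n\<close>, and the even parts \<open>e\<^sub>i\<close> satisfy
  \<open>e\<^sub>i x\<^sub>j + e\<^sub>j x\<^sub>i = 0\<close>, which forces \<open>e\<^sub>i = a x\<^sub>i\<close> for a common odd \<open>a\<close>. For even \<open>n\<close>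
  the same lemma gives \<open>U\<^sup>n \<subseteq> \<Omega>\<close>; for odd \<open>n\<close> the parities of \<open>2 a x\<^sub>i\<close> and
  \<open>x\<^sub>1 \<cdots> x\<^sub>n\<close> differ, so \<open>\<Omega> \<inter> U\<^sup>n\<close> is trivial.
\<close>

section \<open>Maximal abelian subgroups and direct products\<close>

text \<open>A larger abelian subgroup commutes elementwise with \<open>H\<close>, so it lies in
  \<open>H\<close> as soon as \<open>H\<close> contains its own centralizer. Maximality thus becomes
  a centralizer computation.\<close>

lemma (in group) maximal_abelian_subgroupI:
  assumes H: "subgroup H G" and comm: "\<And>x y. x \<in> H \<Longrightarrow> y \<in> H \<Longrightarrow> x \<otimes> y = y \<otimes> x"
    and cent: "\<And>x. x \<in> carrier G \<Longrightarrow> (\<And>h. h \<in> H \<Longrightarrow> x \<otimes> h = h \<otimes> x) \<Longrightarrow> x \<in> H"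
  shows "maximal_abelian_subgroup H G"
  unfolding maximal_abelian_subgroup_def abelian_subgroup_def
proof (intro conjI allI impI)
  show "comm_group (G\<lparr>carrier := H\<rparr>)"
    by (rule group.group_comm_groupI[OF subgroup.subgroup_is_group[OF H is_group]]) (simp add: comm)
next
  fix H'
  assume H': "(subgroup H' G \<and> comm_group (G\<lparr>carrier := H'\<rparr>)) \<and> H \<subseteq> H'"
  interpret H': comm_group "G\<lparr>carrier := H'\<rparr>" using H' by blast
  have "x \<in> H" if x: "x \<in> H'" for x
  proof (rule cent)
    show "x \<in> carrier G" using H' x subgroup.subset by blast
    show "x \<otimes> h = h \<otimes> x" if "h \<in> H" for h
      using H'.m_comm[of x h] x that H' by auto
  qed
  then show "H' = H" using H' by blast
qed (rule H)

text \<open>Elementwise commuting regroups \<open>h l h' l'\<close> as \<open>(h h') (l l')\<close>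
  and makes the inverse of \<open>h l\<close> the product of the inverses.\<close>

lemma (in group) subgroup_set_mult:
  assumes H: "subgroup H G" and L: "subgroup L G"
    and comm: "\<And>h l. h \<in> H \<Longrightarrow> l \<in> L \<Longrightarrow> h \<otimes> l = l \<otimes> h"
  shows "subgroup (H <#> L) G"
proof (rule subgroupI)
  have c: "h \<in> carrier G" "l \<in> carrier G" if "h \<in> H" "l \<in> L" for h l
    using that H L subgroup.subset by blast+
  show "H <#> L \<subseteq> carrier G" using c by (auto simp: set_mult_def)
  show "H <#> L \<noteq> {}"
    using subgroup.one_closed[OF H] subgroup.one_closed[OF L] by (auto simp: set_mult_def)
  fix x assume "x \<in> H <#> L"
  then obtain h l where x: "h \<in> H" "l \<in> L" "x = h \<otimes> l" by (auto simp: set_mult_def)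
  have inv: "inv h \<in> H" "inv l \<in> L" using x H L by (auto intro: subgroup.m_inv_closed)
  have "inv x = inv h \<otimes> inv l"
    using c[OF x(1,2)] comm[OF inv] by (simp add: x(3) inv_mult_group)
  then show "inv x \<in> H <#> L" using inv by (auto simp: set_mult_def)
  fix y assume "y \<in> H <#> L"
  then obtain h' l' where y: "h' \<in> H" "l' \<in> L" "y = h' \<otimes> l'" by (auto simp: set_mult_def)
  have "x \<otimes> y = h \<otimes> (l \<otimes> h') \<otimes> l'" using c x y by (simp add: m_assoc)
  also have "\<dots> = (h \<otimes> h') \<otimes> (l \<otimes> l')"
    using c x y comm[OF y(1) x(2), symmetric] by (simp add: m_assoc)
  finally show "x \<otimes> y \<in> H <#> L"
    using subgroup.m_closed[OF H x(1) y(1)] subgroup.m_closed[OF L x(2) y(2)] by (auto simp: set_mult_def)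
qed

lemma (in group) internal_direct_productI:
  assumes H: "subgroup H G" and L: "subgroup L G"
    and comm: "\<And>h l. h \<in> H \<Longrightarrow> l \<in> L \<Longrightarrow> h \<otimes> l = l \<otimes> h"
    and triv: "H \<inter> L = {\<one>}"
  shows "internal_direct_product H L G"
proof -
  have c: "h \<in> carrier G" "l \<in> carrier G" if "h \<in> H" "l \<in> L" for h l
    using that H L subgroup.subset by blast+
  let ?f = "\<lambda>(h, l). h \<otimes> l"
  have inj: "h = h' \<and> l = l'"
    if hl: "h \<in> H" "l \<in> L" "h' \<in> H" "l' \<in> L" and eq: "h \<otimes> l = h' \<otimes> l'" for h l h' l'
  proof -
    note cl = c[OF hl(1,2)] c[OF hl(3,4)]
    have "inv h' \<otimes> h \<otimes> l = inv h' \<otimes> (h' \<otimes> l')" using cl eq by (simp add: m_assoc)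
    then have "inv h' \<otimes> h \<otimes> l = l'" using cl by (simp add: m_assoc[symmetric])
    \<comment> \<open>The left form lies in \<open>H\<close> and the right form in \<open>L\<close>,
      so the trivial intersection makes the product map injective.\<close>
    then have k: "inv h' \<otimes> h = l' \<otimes> inv l" using cl by (metis inv_closed inv_solve_right m_closed)
    have "inv h' \<otimes> h \<in> H" using hl H by (simp add: subgroup.m_inv_closed subgroup.m_closed)
    moreover have "l' \<otimes> inv l \<in> L" using hl L by (simp add: subgroup.m_inv_closed subgroup.m_closed)
    ultimately have "inv h' \<otimes> h = \<one>" "l' \<otimes> inv l = \<one>" using k triv by auto
    then show ?thesis using cl by (metis inv_equality inv_inv inv_closed)
  qed
  have "?f \<in> iso (G\<lparr>carrier := H\<rparr> \<times>\<times> G\<lparr>carrier := L\<rparr>) (G\<lparr>carrier := H <#> L\<rparr>)"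
    unfolding iso_def hom_def
  proof (intro CollectI conjI ballI)
    show "?f \<in> carrier (G\<lparr>carrier := H\<rparr> \<times>\<times> G\<lparr>carrier := L\<rparr>) \<rightarrow> carrier (G\<lparr>carrier := H <#> L\<rparr>)"
      by (auto simp: set_mult_def)
    show "bij_betw ?f (carrier (G\<lparr>carrier := H\<rparr> \<times>\<times> G\<lparr>carrier := L\<rparr>)) (carrier (G\<lparr>carrier := H <#> L\<rparr>))"
      unfolding bij_betw_def
    proof
      show "inj_on ?f (carrier (G\<lparr>carrier := H\<rparr> \<times>\<times> G\<lparr>carrier := L\<rparr>))"
        by (rule inj_onI) (use inj in auto)
    qed (auto simp: set_mult_def image_iff)
  next
    fix p q
    assume "p \<in> carrier (G\<lparr>carrier := H\<rparr> \<times>\<times> G\<lparr>carrier := L\<rparr>)"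
      "q \<in> carrier (G\<lparr>carrier := H\<rparr> \<times>\<times> G\<lparr>carrier := L\<rparr>)"
    then obtain h l h' l' where pq: "p = (h, l)" "q = (h', l')" "h \<in> H" "l \<in> L" "h' \<in> H" "l' \<in> L"
      by (auto simp: DirProd_def)
    have "(h \<otimes> h') \<otimes> (l \<otimes> l') = h \<otimes> (h' \<otimes> l) \<otimes> l'" using c pq by (simp add: m_assoc)
    also have "\<dots> = (h \<otimes> l) \<otimes> (h' \<otimes> l')" using c pq comm[OF pq(5,4)] by (simp add: m_assoc)
    finally show "?f (p \<otimes>\<^bsub>G\<lparr>carrier := H\<rparr> \<times>\<times> G\<lparr>carrier := L\<rparr>\<^esub> q) =
        ?f p \<otimes>\<^bsub>G\<lparr>carrier := H <#> L\<rparr>\<^esub> ?f q"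
      using pq by (simp add: DirProd_def)
  qed
  then show ?thesis
    unfolding internal_direct_product_def using H L subgroup_set_mult[OF H L comm] by blast
qed

section \<open>The Grassmann algebra\<close>

lemma grassmann_eqI:
  fixes a b :: "('k::comm_ring_1, 'n::{finite,linorder}) grassmann"
  assumes "\<And>S. gcoeff a S = gcoeff b S"
  shows "a = b"
  using assms by (simp add: gcoeff_inject[symmetric] fun_eq_iff)

text \<open>Monomials are iterated products of generators, and every element is a combination of
  monomials. Zero needs no case of its own, since it is \<open>0 *g 1\<close>.\<close>

lemma grassmann_induct [case_names one gvar add mult scale]:
  fixes a :: "('k::comm_ring_1, 'n::{finite,linorder}) grassmann"
  assumes one: "P 1" and gvar: "\<And>i. P (gvar i)"
    and add: "\<And>a b. P a \<Longrightarrow> P b \<Longrightarrow> P (a + b)"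
    and mult: "\<And>a b. P a \<Longrightarrow> P b \<Longrightarrow> P (a * b)"
    and scale: "\<And>c a. P a \<Longrightarrow> P (c *g a)"
  shows "P a"
proof -
  have zero: "P 0"
  proof -
    have "0 *g 1 = (0 :: ('k, 'n) grassmann)" by transfer simp
    then show ?thesis using scale[OF one, of 0] by simp
  qed
  have mono: "P (gmono S)" for S
    using finite[of S]
  proof (induction S rule: finite_linorder_min_induct)
    case (insert i A)
    then have "gmono (insert i A) = (gvar i * gmono A :: ('k, 'n) grassmann)"
      by (intro gmono_insert) simp
    with insert mult gvar show ?case by simp
  qed (use one in \<open>simp add: gmono_empty\<close>)
  have "P (sum f A)" if "\<And>S. P (f S)" for f and A :: "'n set set"
    by (induction A rule: infinite_finite_induct) (simp_all add: zero add that)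
  then have "P (\<Sum>S\<in>UNIV. gcoeff a S *g gmono S)" by (simp add: scale mono)
  then show ?thesis by (simp only: grassmann_expand[of a, symmetric])
qed

section \<open>Homogeneous components and parity\<close>

lemma graded_partD: "a \<in> graded_part D \<Longrightarrow> card S \<notin> D \<Longrightarrow> gcoeff a S = 0"
  by (auto simp: graded_part_def)

lemma graded_part_zero: "0 \<in> graded_part D"
  by (simp add: graded_part_def zero_grassmann.rep_eq)

lemma graded_part_add: "a \<in> graded_part D \<Longrightarrow> b \<in> graded_part D \<Longrightarrow> a + b \<in> graded_part D"
  by (simp add: graded_part_def plus_grassmann.rep_eq) (metis add_0)

lemma graded_part_uminus: "a \<in> graded_part D \<Longrightarrow> - a \<in> graded_part D"
  by (auto simp: graded_part_def uminus_grassmann.rep_eq)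

lemma graded_part_diff: "a \<in> graded_part D \<Longrightarrow> b \<in> graded_part D \<Longrightarrow> a - b \<in> graded_part D"
  using graded_part_add[OF _ graded_part_uminus, of a D b] by simp

lemma graded_part_scale: "a \<in> graded_part D \<Longrightarrow> c *g a \<in> graded_part D"
  by (simp add: graded_part_def gscale.rep_eq) (metis mult_zero_right)

lemma graded_part_mono: "D \<subseteq> E \<Longrightarrow> a \<in> graded_part D \<Longrightarrow> a \<in> graded_part E"
  by (auto simp: graded_part_def)

lemma graded_part_disjoint:
  "a \<in> graded_part D \<Longrightarrow> a \<in> graded_part E \<Longrightarrow> D \<inter> E = {} \<Longrightarrow> a = 0"
  by (rule grassmann_eqI) (auto simp: graded_part_def zero_grassmann.rep_eq)

lemma gvar_graded_part: "gvar i \<in> graded_part D" if "1 \<in> D"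
  using that by (auto simp: graded_part_def gmono.rep_eq)

text \<open>A nonzero coefficient of \<open>a * b\<close> at \<open>S\<close> comes from a splitting
  of \<open>S\<close> whose parts support \<open>a\<close> and \<open>b\<close>, and cardinalities
  add. The free set \<open>F\<close> serves parity arguments and degree bounds alike.\<close>

lemma graded_part_mult:
  assumes a: "a \<in> graded_part D" and b: "b \<in> graded_part E"
    and F: "\<And>i j. i \<in> D \<Longrightarrow> j \<in> E \<Longrightarrow> i + j \<in> F"
  shows "a * b \<in> graded_part F"
  unfolding graded_part_def
proof (rule CollectI, intro allI impI)
  fix S
  assume "gcoeff (a * b) S \<noteq> 0"
  then obtain A where "A \<in> Pow S" "merge_sign A (S - A) * gcoeff a A * gcoeff b (S - A) \<noteq> 0"
    unfolding times_grassmann.rep_eq by (rule sum.not_neutral_contains_not_neutral)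
  then have A: "A \<subseteq> S" "gcoeff a A \<noteq> 0" "gcoeff b (S - A) \<noteq> 0" by auto
  then have "card A \<in> D" "card (S - A) \<in> E" using a b by (auto simp: graded_part_def)
  then have "card A + card (S - A) \<in> F" by (rule F)
  then show "card S \<in> F" using A(1) by (simp add: card_Diff_subset card_mono)
qed

abbreviation even_part :: "('k::comm_ring_1, 'n::{finite,linorder}) grassmann set" where
  "even_part \<equiv> graded_part {d. even d}"

text \<open>The condition is degree at least n, so that this is literally the ideal power described
  by \<open>ideal_power_aug\<close>; \<open>top_part_eq\<close> returns to degree exactly n for
  parity arguments.\<close>

abbreviation top_part :: "('k::comm_ring_1, 'n::{finite,linorder}) grassmann set" where
  "top_part \<equiv> graded_part {CARD('n)..}"

lemma aug_odd: "a \<in> odd_part \<Longrightarrow> a \<in> \<mm>"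
  unfolding odd_part_def aug_ideal_def by (erule graded_part_mono[rotated]) (auto intro: odd_pos Suc_leI)

lemma gvar_odd: "gvar i \<in> odd_part"
  unfolding odd_part_def by (rule gvar_graded_part) simp

lemma odd_mult_odd: "a \<in> odd_part \<Longrightarrow> b \<in> odd_part \<Longrightarrow> a * b \<in> even_part"
  unfolding odd_part_def by (erule (1) graded_part_mult) auto

lemma even_mult_odd: "a \<in> even_part \<Longrightarrow> b \<in> odd_part \<Longrightarrow> a * b \<in> odd_part"
  unfolding odd_part_def by (erule (1) graded_part_mult) auto

text \<open>Here \<open>b = - a\<close> is both even and odd, hence zero. This splits an equation
  into its two parity components.\<close>

lemma even_odd_zero:
  assumes "a \<in> even_part" "b \<in> odd_part" "a + b = 0"
  shows "a = 0" "b = 0"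
proof -
  have "b = - a" using assms(3) by (simp add: eq_neg_iff_add_eq_0 add.commute)
  then have "b \<in> even_part" using assms(1) by (simp add: graded_part_uminus)
  then show "b = 0" using assms(2) unfolding odd_part_def by (rule graded_part_disjoint) auto
  with assms(3) show "a = 0" by simp
qed

lemma even_odd_decomp:
  fixes a :: "('k::comm_ring_1, 'n::{finite,linorder}) grassmann"
  obtains e p where "a = e + p" "e \<in> even_part" "p \<in> odd_part"
proof
  let ?e = "Grassmann (\<lambda>S. if even (card S) then gcoeff a S else 0)"
  let ?p = "Grassmann (\<lambda>S. if odd (card S) then gcoeff a S else 0)"
  show "a = ?e + ?p"
    by (rule grassmann_eqI) (simp add: plus_grassmann.rep_eq Grassmann_inverse)
  show "?e \<in> even_part" "?p \<in> odd_part"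
    by (auto simp: graded_part_def odd_part_def Grassmann_inverse split: if_splits)
qed

section \<open>Signs and graded commutativity\<close>

text \<open>Every pair in \<open>A \<times> B\<close> is an inversion for exactly one of the two
  orders, so the two exponents add up to \<open>card A * card B\<close>.\<close>

lemma merge_sign_swap:
  fixes A B :: "'n::{finite,linorder} set"
  assumes "A \<inter> B = {}"
  shows "merge_sign B A = (- 1) ^ (card A * card B) * (merge_sign A B :: 'a::ring_1)"
proof -
  let ?X = "{(a, b). a \<in> A \<and> b \<in> B \<and> b < a}" and ?Y = "{(b, a). b \<in> B \<and> a \<in> A \<and> a < b}"
  have "card A * card B = card (A \<times> B)" by simp
  also have "A \<times> B = ?X \<union> prod.swap ` ?Y"
  proof -
    have "b < a \<or> a < b" if "a \<in> A" "b \<in> B" for a b using that assms by (metis disjoint_iff linorder_neqE)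
    moreover have "prod.swap ` ?Y = {(a, b). a \<in> A \<and> b \<in> B \<and> a < b}" by (auto simp: image_iff)
    ultimately show ?thesis by auto
  qed
  also have "card \<dots> = card ?X + card (prod.swap ` ?Y)"
    by (rule card_Un_disjoint) auto
  also have "card (prod.swap ` ?Y) = card ?Y" by (rule card_image) simp
  finally have eq: "card A * card B = card ?X + card ?Y" .
  show ?thesis unfolding merge_sign_def eq
    by (cases "even (card ?X)"; cases "even (card ?Y)") simp_all
qed

text \<open>Passing to complements in \<open>S\<close> indexes \<open>b * a\<close> by the same
  splittings as \<open>a * b\<close>, so that the two products can be compared term by term.\<close>

lemma gcoeff_mult_swap:
  fixes a b :: "('k::comm_ring_1, 'n::{finite,linorder}) grassmann"
  shows "gcoeff (b * a) S =
    (\<Sum>A\<in>Pow S. (- 1) ^ (card A * card (S - A)) * merge_sign A (S - A) * gcoeff a A * gcoeff b (S - A))"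
  unfolding times_grassmann.rep_eq
proof (rule sum.reindex_bij_witness[where i = "\<lambda>A. S - A" and j = "\<lambda>A. S - A"], goal_cases)
  case (5 A)
  then have "S - (S - A) = A" by auto
  moreover have "merge_sign A (S - A) = (- 1) ^ (card (S - A) * card A) * (merge_sign (S - A) A :: 'k)"
    by (rule merge_sign_swap) auto
  ultimately show ?case
    by (cases "even (card (S - A) * card A)") (simp_all add: ac_simps)
qed auto

text \<open>Only sets \<open>A\<close> of even size contribute, and for them the swap sign is
  1.\<close>

lemma even_commute:
  assumes "a \<in> even_part"
  shows "a * b = b * a"
proof (rule grassmann_eqI)
  fix S
  show "gcoeff (a * b) S = gcoeff (b * a) S"
    unfolding gcoeff_mult_swap[of b a] times_grassmann.rep_eq[of a b]
  proof (rule sum.cong[OF refl])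
    fix A
    show "merge_sign A (S - A) * gcoeff a A * gcoeff b (S - A) =
        (- 1) ^ (card A * card (S - A)) * merge_sign A (S - A) * gcoeff a A * gcoeff b (S - A)"
      using graded_partD[OF assms, of A] by (cases "even (card A)") simp_all
  qed
qed

text \<open>In a contributing splitting both parts have odd size, so the swap sign is -1.\<close>

lemma odd_anticommute:
  assumes "a \<in> odd_part" "b \<in> odd_part"
  shows "a * b = - (b * a)"
proof (rule grassmann_eqI)
  fix S
  show "gcoeff (a * b) S = gcoeff (- (b * a)) S"
    unfolding uminus_grassmann.rep_eq gcoeff_mult_swap[of b a] times_grassmann.rep_eq[of a b] sum_negf[symmetric]
  proof (rule sum.cong[OF refl])
    fix A
    show "merge_sign A (S - A) * gcoeff a A * gcoeff b (S - A) =
        - ((- 1) ^ (card A * card (S - A)) * merge_sign A (S - A) * gcoeff a A * gcoeff b (S - A))"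
      using graded_partD[OF assms(1)[unfolded odd_part_def], of A]
        graded_partD[OF assms(2)[unfolded odd_part_def], of "S - A"]
      by (cases "odd (card A) \<and> odd (card (S - A))") auto
  qed
qed

section \<open>Products in top degree and products with generators\<close>

text \<open>The product would have degree above n, but no set of generators is that large.\<close>

lemma aug_mult_top:
  fixes a t :: "('k::comm_ring_1, 'n::{finite,linorder}) grassmann"
  assumes "a \<in> \<mm>" "t \<in> top_part"
  shows "a * t = 0" "t * a = 0"
proof -
  have *: "b = 0" if "b \<in> graded_part {Suc CARD('n)..}" for b :: "('k, 'n) grassmann"
  proof (rule grassmann_eqI)
    fix S :: "'n set"
    have "card S \<le> CARD('n)" by (rule card_mono) auto
    then show "gcoeff b S = gcoeff 0 S" using that by (simp add: graded_partD zero_grassmann.rep_eq)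
  qed
  show "a * t = 0"
    by (rule *, rule graded_part_mult[OF assms[unfolded aug_ideal_def]]) auto
  show "t * a = 0"
    by (rule *, rule graded_part_mult[OF assms(2) assms(1)[unfolded aug_ideal_def]]) auto
qed

lemma top_part_eq: "top_part = (graded_part {CARD('n)} :: ('k::comm_ring_1, 'n::{finite,linorder}) grassmann set)"
proof -
  have "card S \<in> {CARD('n)..} \<longleftrightarrow> card S \<in> {CARD('n)}" for S :: "'n set"
    using card_mono[OF finite subset_UNIV, of S] by auto
  then show ?thesis by (simp only: graded_part_def)
qed

text \<open>Among the splittings of \<open>S\<close>, only the one with second part
  \<open>{i}\<close> contributes.\<close>

lemma gcoeff_mult_gvar:
  fixes a :: "('k::comm_ring_1, 'n::{finite,linorder}) grassmann"
  shows "gcoeff (a * gvar i) S =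
    (if i \<in> S then merge_sign (S - {i}) {i} * gcoeff a (S - {i}) else 0)"
proof -
  define f :: "'n set \<Rightarrow> 'k" where
    "f A = merge_sign A (S - A) * gcoeff a A * gcoeff (gvar i) (S - A)" for A
  have sum: "gcoeff (a * gvar i) S = sum f (Pow S)"
    unfolding times_grassmann.rep_eq f_def ..
  have zero: "f A = 0" if "S - A \<noteq> {i}" for A
    using that by (simp add: f_def gmono.rep_eq)
  show ?thesis
  proof (cases "i \<in> S")
    case True
    then have SS: "S - (S - {i}) = {i}" by auto
    have "sum f (Pow S) = f (S - {i}) + sum f (Pow S - {S - {i}})"
      by (rule sum.remove) auto
    also have "sum f (Pow S - {S - {i}}) = 0"
      by (rule sum.neutral, rule ballI, rule zero) blast
    also have "f (S - {i}) = merge_sign (S - {i}) {i} * gcoeff a (S - {i})"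
      unfolding f_def SS by (simp add: gmono.rep_eq)
    finally show ?thesis using True sum by simp
  next
    case False
    have "sum f (Pow S) = 0"
      by (rule sum.neutral, rule ballI, rule zero) (use False in blast)
    then show ?thesis using False sum by simp
  qed
qed

text \<open>Multiplying by a sign a second time strips it from an equation without any cancellation
  law in the coefficient ring.\<close>

lemma merge_sign_square: "merge_sign A B * (merge_sign A B * c) = (c :: 'a::ring_1)"
  unfolding merge_sign_def by (cases "even (card {(a, b). a \<in> A \<and> b \<in> B \<and> b < a})") simp_all

text \<open>If \<open>i\<close> is missing from \<open>S\<close>, the coefficient of
  \<open>a\<close> at \<open>S\<close> reappears up to sign in \<open>a * gvar i\<close> at
  \<open>insert i S\<close>. Hence only the full set can support \<open>a\<close>.\<close>

lemma gvar_annihilator: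
  fixes a :: "('k::comm_ring_1, 'n::{finite,linorder}) grassmann"
  assumes "\<And>i. a * gvar i = 0"
  shows "a \<in> top_part"
  unfolding graded_part_def
proof (rule CollectI, intro allI impI)
  fix S
  assume S: "gcoeff a S \<noteq> 0"
  have "i \<in> S" for i
  proof (rule ccontr)
    assume i: "i \<notin> S"
    then have "merge_sign S {i} * gcoeff a S = 0"
      using gcoeff_mult_gvar[of a i "insert i S"] assms[of i] by (simp add: zero_grassmann.rep_eq)
    then show False using S merge_sign_square[of S "{i}" "gcoeff a S"] by simp
  qed
  then have "S = UNIV" by auto
  then show "card S \<in> {CARD('n)..}" by simp
qed

text \<open>Exactness of the Koszul complex: the relations force the candidates
  \<open>merge_sign T {i} * gcoeff (e i) (insert i T)\<close> for the coefficient of \<open>a\<close> at \<open>T\<close> to agree for all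
  \<open>i \<notin> T\<close>.\<close>

lemma koszul_exact:
  fixes e :: "'n::{finite,linorder} \<Rightarrow> ('k::comm_ring_1, 'n) grassmann"
  assumes rel: "\<And>i j. e i * gvar j + e j * gvar i = 0" and sq: "\<And>i. e i * gvar i = 0"
    and even: "\<And>i. e i \<in> even_part"
  obtains a where "a \<in> odd_part" "\<And>i. e i = a * gvar i"
proof -
  define cand where "cand i T = merge_sign T {i} * gcoeff (e i) (insert i T)" for i T
  define pick where "pick T = (SOME i. i \<notin> T)" for T :: "'n set"
  \<comment> \<open>Every generator kills the top monomial, so the coefficient at
    \<open>UNIV\<close> is free; the value 0 keeps \<open>a\<close> odd for every n. The index
    chosen by \<open>pick\<close> is immaterial by the fact \<open>cand\<close> below.\<close>
  define a where "a = Grassmann (\<lambda>T. if T = UNIV then 0 else cand (pick T) T)"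
  have pick: "pick T \<notin> T" if "T \<noteq> UNIV" for T
  proof -
    obtain i where "i \<notin> T" using \<open>T \<noteq> UNIV\<close> by blast
    then show ?thesis unfolding pick_def by (rule someI)
  qed
  have cand: "cand i T = cand j T" if "i \<notin> T" "j \<notin> T" for i j T
  proof (cases "i = j")
    case False
    let ?s = "merge_sign :: _ \<Rightarrow> _ \<Rightarrow> 'k"
    have Diff: "insert i (insert j T) - {i} = insert j T" "insert i (insert j T) - {j} = insert i T"
      using that False by auto
    \<comment> \<open>The relation is read off at the set \<open>T\<close> enlarged by both
      indices.\<close>
    have "gcoeff (e i * gvar j + e j * gvar i) (insert i (insert j T)) = 0"
      by (simp add: rel zero_grassmann.rep_eq)
    then have "?s (insert i T) {j} * gcoeff (e i) (insert i T) +
        ?s (insert j T) {i} * gcoeff (e j) (insert j T) = 0"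
      using that False by (simp add: plus_grassmann.rep_eq gcoeff_mult_gvar Diff)
    moreover have "?s (insert i T) {j} = ?s {i} {j} * ?s T {j}"
      "?s (insert j T) {i} = ?s {j} {i} * ?s T {i}"
      using merge_sign_Un_left[of "{i}" T "{j}"] merge_sign_Un_left[of "{j}" T "{i}"] that by auto
    moreover have "?s {j} {i} = - ?s {i} {j}"
      using merge_sign_swap[of "{i}" "{j}"] False by simp
    ultimately have "?s {i} {j} * (?s T {j} * gcoeff (e i) (insert i T) - ?s T {i} * gcoeff (e j) (insert j T)) = 0"
      by (simp only: right_diff_distrib mult.assoc mult_minus_left add_uminus_conv_diff)
    then have "?s T {j} * gcoeff (e i) (insert i T) - ?s T {i} * gcoeff (e j) (insert j T) = 0"
      using merge_sign_square[of "{i}" "{j}"] by (metis mult_zero_right)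
    then have "?s T {i} * (?s T {j} * (?s T {j} * gcoeff (e i) (insert i T))) =
        ?s T {i} * (?s T {j} * (?s T {i} * gcoeff (e j) (insert j T)))"
      by simp
    also have "\<dots> = ?s T {j} * (?s T {i} * (?s T {i} * gcoeff (e j) (insert j T)))"
      by (simp only: mult.left_commute)
    finally have "?s T {i} * gcoeff (e i) (insert i T) = ?s T {j} * gcoeff (e j) (insert j T)"
      by (simp only: merge_sign_square)
    then show ?thesis by (simp only: cand_def)
  qed simp
  have coeff_a: "gcoeff a T = cand i T" if "i \<notin> T" for i T
  proof -
    have "T \<noteq> UNIV" using that by auto
    then show ?thesis using cand[OF that pick] by (simp add: a_def Grassmann_inverse)
  qed
  have "a \<in> odd_part"
    unfolding odd_part_def graded_part_def
  proof (rule CollectI, intro allI impI)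
    fix T
    assume nz: "gcoeff a T \<noteq> 0"
    then have "T \<noteq> UNIV" by (auto simp: a_def Grassmann_inverse)
    then have "gcoeff (e (pick T)) (insert (pick T) T) \<noteq> 0"
      using nz coeff_a[OF pick] by (auto simp: cand_def)
    then have "even (card (insert (pick T) T))" using even[of "pick T"] by (auto simp: graded_part_def)
    then show "card T \<in> {d. odd d}" using pick[OF \<open>T \<noteq> UNIV\<close>] by simp
  qed
  moreover have "e i = a * gvar i" for i
  proof (rule grassmann_eqI)
    fix S
    show "gcoeff (e i) S = gcoeff (a * gvar i) S"
    proof (cases "i \<in> S")
      case True
      then show ?thesis
        using coeff_a[of i "S - {i}"]
        by (simp add: gcoeff_mult_gvar cand_def merge_sign_square insert_absorb)
    next
      case False
      \<comment> \<open>The hypothesis \<open>sq\<close> excludes from \<open>e i\<close> the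
        monomials avoiding \<open>i\<close>, which cannot occur in
        \<open>a * gvar i\<close>.\<close>
      then have "merge_sign S {i} * gcoeff (e i) S = 0"
        using gcoeff_mult_gvar[of "e i" i "insert i S"] sq[of i] by (simp add: zero_grassmann.rep_eq)
      then have "gcoeff (e i) S = 0" using merge_sign_square[of S "{i}" "gcoeff (e i) S"] by simp
      then show ?thesis using False by (simp add: gcoeff_mult_gvar)
    qed
  qed
  ultimately show thesis by (rule that)
qed

text \<open>One inclusion is additivity of degree; for the other, the least generator is split off
  each monomial. Membership in an ideal power thereby becomes a degree condition.\<close>

lemma ideal_power_aug: "ideal_power \<mm> k = (graded_part {k..} :: ('k::comm_ring_1, 'n::{finite,linorder}) grassmann set)"
proof (induction k)
  case 0
  show ?case by (auto simp: graded_part_def)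
next
  case (Suc k)
  show ?case
  proof
    show "ideal_power \<mm> (Suc k) \<subseteq> (graded_part {Suc k..} :: ('k, 'n) grassmann set)"
    proof
      fix a :: "('k, 'n) grassmann"
      assume "a \<in> ideal_power \<mm> (Suc k)"
      then show "a \<in> graded_part {Suc k..}"
        unfolding ideal_power.simps Suc.IH
      proof induction
        case (prod a b)
        then show ?case unfolding aug_ideal_def by (rule graded_part_mult) auto
      qed (rule graded_part_add)
    qed
    show "(graded_part {Suc k..} :: ('k, 'n) grassmann set) \<subseteq> ideal_power \<mm> (Suc k)"
    proof
      fix a :: "('k, 'n) grassmann"
      assume a: "a \<in> graded_part {Suc k..}"
      let ?J = "ideal_mult \<mm> (graded_part {k..}) :: ('k, 'n) grassmann set"
      have zero: "0 \<in> ?J"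
        using ideal_mult.prod[OF _ graded_part_zero, of 0 \<mm> "{k..}"]
        by (simp add: aug_ideal_def graded_part_zero)
      have summand: "gcoeff a S *g gmono S \<in> ?J" for S
      proof (cases "Suc k \<le> card S")
        case True
        then have ne: "S \<noteq> {}" by auto
        let ?A = "S - {Min S}"
        have "\<forall>a\<in>?A. Min S < a" by (metis Diff_iff Min_le finite order_le_less singletonI)
        then have "gmono S = gvar (Min S) * (gmono ?A :: ('k, 'n) grassmann)"
          using gmono_insert[of ?A "Min S"] ne by (simp add: insert_absorb)
        then have "gcoeff a S *g gmono S = gvar (Min S) * (gcoeff a S *g gmono ?A :: ('k, 'n) grassmann)"
          by (simp add: gscale_simps)
        moreover have "(gmono ?A :: ('k, 'n) grassmann) \<in> graded_part {k..}"
          using True ne by (auto simp: graded_part_def gmono.rep_eq)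
        ultimately show ?thesis
          by (auto intro!: ideal_mult.prod graded_part_scale gvar_graded_part simp: aug_ideal_def)
      next
        case False
        then have "gcoeff a S *g gmono S = 0"
          using a by (intro grassmann_eqI) (simp add: graded_partD gscale.rep_eq zero_grassmann.rep_eq)
        then show ?thesis using zero by simp
      qed
      have "sum f A \<in> ?J" if "\<And>S. f S \<in> ?J" for f and A :: "'n set set"
        by (induction A rule: infinite_finite_induct) (use zero that in \<open>auto intro: ideal_mult.sum\<close>)
      then have "(\<Sum>S\<in>UNIV. gcoeff a S *g gmono S) \<in> ?J" by (simp add: summand)
      then show "a \<in> ideal_power \<mm> (Suc k)"
        by (simp only: ideal_power.simps Suc.IH grassmann_expand[of a, symmetric])
    qed
  qed
qed

section \<open>Automorphisms\<close>

lemma alg_aut_simps: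
  assumes "\<sigma> \<in> alg_aut"
  shows "\<sigma> (a + b) = \<sigma> a + \<sigma> b" "\<sigma> (a * b) = \<sigma> a * \<sigma> b" "\<sigma> 1 = 1" "\<sigma> (c *g a) = c *g \<sigma> a"
    "\<sigma> 0 = 0" "\<sigma> (- a) = - \<sigma> a" "\<sigma> (a - b) = \<sigma> a - \<sigma> b"
proof -
  show *: "\<sigma> (a + b) = \<sigma> a + \<sigma> b" "\<sigma> (a * b) = \<sigma> a * \<sigma> b" "\<sigma> 1 = 1" "\<sigma> (c *g a) = c *g \<sigma> a" for a b c
    using assms by (auto simp: alg_aut_def)
  show zero: "\<sigma> 0 = 0" using *(1)[of 0 0] by simp
  show neg: "\<sigma> (- a) = - \<sigma> a" for a using *(1)[of "- a" a] by (simp add: zero eq_neg_iff_add_eq_0)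
  show "\<sigma> (a - b) = \<sigma> a - \<sigma> b" using *(1)[of a "- b"] by (simp add: neg)
qed

lemma alg_aut_eqI:
  fixes \<sigma> \<tau> :: "('k::comm_ring_1, 'n::{finite,linorder}) grassmann \<Rightarrow> ('k, 'n) grassmann"
  assumes "\<sigma> \<in> alg_aut" "\<tau> \<in> alg_aut" "\<And>i. \<sigma> (gvar i) = \<tau> (gvar i)"
  shows "\<sigma> = \<tau>"
proof
  show "\<sigma> a = \<tau> a" for a
    by (induction a rule: grassmann_induct)
       (simp_all add: alg_aut_simps[OF assms(1)] alg_aut_simps[OF assms(2)] assms(3))
qed

lemma alg_aut_comp: "\<sigma> \<in> alg_aut \<Longrightarrow> \<tau> \<in> alg_aut \<Longrightarrow> \<sigma> \<circ> \<tau> \<in> alg_aut"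
  by (auto simp: alg_aut_def bij_comp)

lemma U_setD: "\<sigma> \<in> U_set \<Longrightarrow> \<sigma> \<in> alg_aut"
  by (simp add: U_set_def)

lemma U_group_simps [simp]:
  "carrier U_group = U_set" "mult U_group = (\<circ>)" "one U_group = id"
  by (simp_all add: U_group_def aut_group_def)

section \<open>The subgroup of automorphisms moving generators only in top degree\<close>

lemma top_part_absorb:
  fixes t :: "('k::comm_ring_1, 'n::{finite,linorder}) grassmann"
  assumes "t \<in> top_part"
  shows "a * t \<in> top_part" "t * a \<in> top_part"
proof -
  have "a \<in> graded_part UNIV" by (simp add: graded_part_def)
  then show "a * t \<in> top_part" "t * a \<in> top_part"
    using graded_part_mult[of a UNIV t "{CARD('n)..}" "{CARD('n)..}"]
      graded_part_mult[of t "{CARD('n)..}" a UNIV "{CARD('n)..}"] assms by auto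
qed

text \<open>Checking generators suffices: in \<open>\<sigma> (a * b) - a * b = (\<sigma> a - a) *
  \<sigma> b + a * (\<sigma> b - b)\<close> both summands stay in the ideal
  \<open>top_part\<close>.\<close>

lemma U_pow_top_iff:
  fixes \<sigma> :: "('k::comm_ring_1, 'n::{finite,linorder}) grassmann \<Rightarrow> ('k, 'n) grassmann"
  shows "\<sigma> \<in> U_pow CARD('n) \<longleftrightarrow> \<sigma> \<in> U_set \<and> (\<forall>i. \<sigma> (gvar i) - gvar i \<in> top_part)"
proof
  assume "\<sigma> \<in> U_pow CARD('n)"
  then show "\<sigma> \<in> U_set \<and> (\<forall>i. \<sigma> (gvar i) - gvar i \<in> top_part)"
    by (simp add: U_pow_def ideal_power_aug aug_odd[OF gvar_odd])
next
  assume asm: "\<sigma> \<in> U_set \<and> (\<forall>i. \<sigma> (gvar i) - gvar i \<in> top_part)"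
  then have \<sigma>: "\<sigma> \<in> alg_aut" by (simp add: U_setD)
  note hom = alg_aut_simps[OF \<sigma>]
  have "\<sigma> a - a \<in> top_part" for a
  proof (induction a rule: grassmann_induct)
    case one
    show ?case by (simp add: hom graded_part_zero)
  next
    case (gvar i)
    then show ?case using asm by blast
  next
    case (add a b)
    from graded_part_add[OF add] show ?case by (simp add: hom algebra_simps)
  next
    case (mult a b)
    have "(\<sigma> a - a) * \<sigma> b + a * (\<sigma> b - b) \<in> top_part"
      by (intro graded_part_add top_part_absorb mult)
    then show ?case by (simp add: hom algebra_simps)
  next
    case (scale c a)
    have "c *g \<sigma> a - c *g a = c *g (\<sigma> a - a)" by transfer (simp add: right_diff_distrib)
    then show ?case using graded_part_scale[OF scale] by (simp add: hom)
  qed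
  then show "\<sigma> \<in> U_pow CARD('n)" using asm by (simp add: U_pow_def ideal_power_aug)
qed

lemma top_part_aug:
  fixes t :: "('k::comm_ring_1, 'n::{finite,linorder}) grassmann"
  shows "t \<in> top_part \<Longrightarrow> t \<in> \<mm>"
  unfolding aug_ideal_def by (erule graded_part_mono[rotated]) (auto simp: Suc_le_eq)

text \<open>In \<open>(a + s) * (b + t)\<close> with \<open>a\<close>, \<open>b\<close> in the
  augmentation ideal and \<open>s\<close>, \<open>t\<close> of top degree, every term except
  \<open>a * b\<close> vanishes.\<close>

lemma U_pow_top_fixes_square:
  fixes \<sigma> :: "('k::comm_ring_1, 'n::{finite,linorder}) grassmann \<Rightarrow> ('k, 'n) grassmann"
  assumes \<sigma>: "\<sigma> \<in> U_pow CARD('n)" and b: "b \<in> graded_part {2..}"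
  shows "\<sigma> b = b"
proof -
  have hom: "\<sigma> (a + b) = \<sigma> a + \<sigma> b" "\<sigma> (a * b) = \<sigma> a * \<sigma> b" for a b
    using \<sigma> by (auto simp: U_pow_def U_set_def alg_aut_def)
  have top: "\<sigma> a - a \<in> top_part" if "a \<in> \<mm>" for a
    using \<sigma> that by (simp add: U_pow_def ideal_power_aug)
  have one: "ideal_mult \<mm> UNIV = (\<mm> :: ('k, 'n) grassmann set)"
    using ideal_power_aug[of 1] by (simp add: aug_ideal_def)
  have "b \<in> ideal_mult \<mm> (ideal_mult \<mm> UNIV)"
    using b ideal_power_aug[of 2, where 'k = 'k and 'n = 'n] by (simp add: numeral_2_eq_2)
  then show ?thesis
    unfolding one
  proof induction
    case (prod a b)
    have "\<sigma> a * \<sigma> b = (a + (\<sigma> a - a)) * (b + (\<sigma> b - b))" by simp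
    also have "\<dots> = a * b + a * (\<sigma> b - b) + (\<sigma> a - a) * b + (\<sigma> a - a) * (\<sigma> b - b)"
      by (simp only: distrib_left distrib_right add.assoc add.left_commute)
    also have "\<dots> = a * b"
      using prod top[of a] top[of b] by (simp add: aug_mult_top top_part_aug)
    finally show ?case by (simp add: hom)
  qed (simp add: hom)
qed

text \<open>This is where \<open>CARD('n) \<ge> 2\<close> enters: top-degree displacements lie in
  the square of the augmentation ideal, hence are fixed by the top-degree subgroup.\<close>

lemma top_part_square:
  fixes t :: "('k::comm_ring_1, 'n::{finite,linorder}) grassmann"
  assumes "CARD('n) \<ge> 2"
  shows "t \<in> top_part \<Longrightarrow> t \<in> graded_part {2..}"
  using assms by (auto elim: graded_part_mono[rotated])

text \<open>The displacements \<open>\<sigma> (gvar i) - gvar i\<close> add under composition and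
  change sign under inversion.\<close>

lemma subgroup_U_pow_top:
  assumes n: "CARD('n::{finite,linorder}) \<ge> 2"
  shows "subgroup (U_pow CARD('n) :: (('k::comm_ring_1, 'n) grassmann \<Rightarrow> _) set) U_group"
proof (rule group.subgroupI[OF group_U_group])
  show "U_pow CARD('n) \<subseteq> carrier (U_group :: (('k, 'n) grassmann \<Rightarrow> _) monoid)"
    by (auto simp: U_pow_def)
  have "id \<in> (U_set :: (('k, 'n) grassmann \<Rightarrow> _) set)"
    using monoid.one_closed[OF group.is_monoid[OF group_U_group]] by simp
  then have "id \<in> (U_pow CARD('n) :: (('k, 'n) grassmann \<Rightarrow> _) set)"
    by (simp add: U_pow_def ideal_power_aug graded_part_zero)
  then show "(U_pow CARD('n) :: (('k, 'n) grassmann \<Rightarrow> _) set) \<noteq> {}" by auto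
next
  fix \<sigma> \<tau> :: "('k, 'n) grassmann \<Rightarrow> ('k, 'n) grassmann"
  assume \<sigma>: "\<sigma> \<in> U_pow CARD('n)" and \<tau>: "\<tau> \<in> U_pow CARD('n)"
  have U: "\<sigma> \<in> U_set" "\<tau> \<in> U_set" using \<sigma> \<tau> by (auto simp: U_pow_def)
  note hom = alg_aut_simps[OF U_setD[OF U(1)]]
  have "\<sigma> (\<tau> (gvar i)) - gvar i \<in> top_part" for i
  proof -
    have t: "\<sigma> (gvar i) - gvar i \<in> top_part" "\<tau> (gvar i) - gvar i \<in> top_part"
      using \<sigma> \<tau> by (auto simp: U_pow_top_iff)
    have "\<sigma> (\<tau> (gvar i)) = \<sigma> (gvar i) + \<sigma> (\<tau> (gvar i) - gvar i)" by (simp add: hom)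
    also have "\<sigma> (\<tau> (gvar i) - gvar i) = \<tau> (gvar i) - gvar i"
      by (rule U_pow_top_fixes_square[OF \<sigma> top_part_square[OF n t(2)]])
    finally have "\<sigma> (\<tau> (gvar i)) - gvar i = (\<sigma> (gvar i) - gvar i) + (\<tau> (gvar i) - gvar i)"
      by (simp only: add_diff_eq diff_add_eq)
    then show ?thesis using graded_part_add[OF t] by (simp only:)
  qed
  moreover have "\<sigma> \<circ> \<tau> \<in> U_set"
    using monoid.m_closed[OF group.is_monoid[OF group_U_group], of \<sigma> \<tau>] U by simp
  ultimately show "\<sigma> \<otimes>\<^bsub>U_group\<^esub> \<tau> \<in> U_pow CARD('n)" by (simp add: U_pow_top_iff)
next
  fix \<sigma> :: "('k, 'n) grassmann \<Rightarrow> ('k, 'n) grassmann"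
  assume \<sigma>: "\<sigma> \<in> U_pow CARD('n)"
  then have U: "\<sigma> \<in> U_set" by (simp add: U_pow_def)
  let ?\<tau> = "inv\<^bsub>U_group\<^esub> \<sigma>"
  have \<tau>: "?\<tau> \<in> U_set" using group.inv_closed[OF group_U_group, of \<sigma>] U by simp
  have "\<sigma> \<circ> ?\<tau> = id" using group.r_inv[OF group_U_group, of \<sigma>] U by simp
  then have inv: "\<sigma> (?\<tau> a) = a" for a by (simp add: fun_eq_iff)
  note hom = alg_aut_simps[OF U_setD[OF U]]
  have "?\<tau> (gvar i) - gvar i \<in> top_part" for i
  proof -
    \<comment> \<open>Membership of \<open>?\<tau>\<close> in \<open>U_set\<close> already puts its
      displacement in degree at least 2, where \<open>\<sigma>\<close> is the identity.\<close>
    have "?\<tau> (gvar i) - gvar i \<in> graded_part {2..}"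
      using \<tau> by (simp add: U_set_def ideal_power_aug)
    then have "\<sigma> (?\<tau> (gvar i) - gvar i) = ?\<tau> (gvar i) - gvar i"
      by (rule U_pow_top_fixes_square[OF \<sigma>])
    then have "?\<tau> (gvar i) - gvar i = - (\<sigma> (gvar i) - gvar i)" by (simp add: hom inv)
    then show ?thesis using \<sigma> by (simp only: graded_part_uminus U_pow_top_iff)
  qed
  with \<tau> show "?\<tau> \<in> U_pow CARD('n)" by (simp add: U_pow_top_iff)
qed

lemma U_pow_top_commute:
  fixes \<sigma> \<tau> :: "('k::comm_ring_1, 'n::{finite,linorder}) grassmann \<Rightarrow> ('k, 'n) grassmann"
  assumes n: "CARD('n) \<ge> 2" and \<sigma>: "\<sigma> \<in> U_pow CARD('n)" and \<tau>: "\<tau> \<in> U_pow CARD('n)"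
  shows "\<sigma> \<circ> \<tau> = \<tau> \<circ> \<sigma>"
proof (rule alg_aut_eqI)
  have U: "\<sigma> \<in> alg_aut" "\<tau> \<in> alg_aut" using \<sigma> \<tau> by (auto simp: U_pow_def U_set_def)
  then show "\<sigma> \<circ> \<tau> \<in> alg_aut" "\<tau> \<circ> \<sigma> \<in> alg_aut" by (simp_all add: alg_aut_comp)
  fix i
  have t: "\<sigma> (gvar i) - gvar i \<in> top_part" "\<tau> (gvar i) - gvar i \<in> top_part"
    using \<sigma> \<tau> by (auto simp: U_pow_top_iff)
  have "\<sigma> (\<tau> (gvar i) - gvar i) = \<tau> (gvar i) - gvar i" "\<tau> (\<sigma> (gvar i) - gvar i) = \<sigma> (gvar i) - gvar i"
    using U_pow_top_fixes_square[OF \<sigma> top_part_square[OF n t(2)]]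
      U_pow_top_fixes_square[OF \<tau> top_part_square[OF n t(1)]] .
  \<comment> \<open>Both sides equal \<open>\<sigma> (gvar i) + \<tau> (gvar i)\<close>.\<close>
  then have "gvar i + \<sigma> (\<tau> (gvar i)) = gvar i + \<tau> (\<sigma> (gvar i))"
    by (simp add: alg_aut_simps[OF U(1)] alg_aut_simps[OF U(2)] algebra_simps)
  then show "(\<sigma> \<circ> \<tau>) (gvar i) = (\<tau> \<circ> \<sigma>) (gvar i)" by simp
qed

section \<open>The group \<open>\<Omega>\<close>\<close>

context
  assumes half: "\<exists>h::'k::comm_ring_1. 2 * h = 1"
begin

text \<open>Doubling is injective on each coordinate because 2 is a unit of the scalars.\<close>

lemma add_self_eq_zero:
  fixes a :: "('k, 'n::{finite,linorder}) grassmann"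
  assumes "a + a = 0"
  shows "a = 0"
proof (rule grassmann_eqI)
  fix S
  obtain h :: 'k where h: "2 * h = 1" using half by blast
  have "gcoeff a S + gcoeff a S = 0"
    using assms by (metis plus_grassmann.rep_eq zero_grassmann.rep_eq)
  then have "h * (gcoeff a S + gcoeff a S) = 0" by simp
  then have "(2 * h) * gcoeff a S = 0" by (simp add: algebra_simps)
  then show "gcoeff a S = gcoeff 0 S" by (simp add: h zero_grassmann.rep_eq)
qed

lemma odd_square:
  fixes a :: "('k, 'n::{finite,linorder}) grassmann"
  assumes "a \<in> odd_part"
  shows "a * a = 0"
  by (rule add_self_eq_zero, rule iffD1[OF eq_neg_iff_add_eq_0], rule odd_anticommute[OF assms assms])

text \<open>Since \<open>a * a = 0\<close>, the inverse of \<open>1 + a\<close> is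
  \<open>1 - a\<close>; this formula replaces the definite description in
  \<open>unit_inv\<close>.\<close>

lemma conj_by_odd_unit:
  fixes a :: "('k, 'n::{finite,linorder}) grassmann"
  assumes "a \<in> odd_part"
  shows "conj_by (1 + a) x = (1 + a) * x * (1 - a)"
proof -
  have "unit_inv (1 + a) = 1 - a"
    by (rule unit_inv_eq) (simp_all add: algebra_simps odd_square[OF assms])
  then show ?thesis by (simp add: conj_by_def)
qed

lemma conj_by_even:
  fixes a :: "('k, 'n::{finite,linorder}) grassmann"
  assumes a: "a \<in> odd_part" and x: "x \<in> even_part"
  shows "conj_by (1 + a) x = x"
proof -
  have "conj_by (1 + a) x = x * ((1 + a) * (1 - a))"
    unfolding conj_by_odd_unit[OF a] even_commute[OF x, of "1 + a", symmetric] mult.assoc ..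
  also have "(1 + a) * (1 - a) = 1" by (simp add: algebra_simps odd_square[OF a])
  finally show ?thesis by simp
qed

text \<open>Anticommuting turns \<open>a * x - x * a\<close> into twice \<open>a * x\<close> and
  kills the cubic term through \<open>a * a = 0\<close>. The double is written as a sum to match
  \<open>add_self_eq_zero\<close>.\<close>

lemma conj_by_odd:
  fixes a :: "('k, 'n::{finite,linorder}) grassmann"
  assumes a: "a \<in> odd_part" and x: "x \<in> odd_part"
  shows "conj_by (1 + a) x = x + (a * x + a * x)"
proof -
  have xa: "x * a = - (a * x)" by (rule odd_anticommute[OF x a])
  have "a * x * a = - (a * a * x)" by (simp only: mult.assoc xa mult_minus_right)
  then have axa: "a * x * a = 0" by (simp add: odd_square[OF a])
  have "(1 + a) * x * (1 - a) = x + a * x - x * a - a * x * a" by (simp add: algebra_simps)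
  then show ?thesis by (simp add: conj_by_odd_unit[OF a] axa xa add.assoc)
qed

lemma conj_by_top:
  fixes a :: "('k, 'n::{finite,linorder}) grassmann"
  assumes a: "a \<in> odd_part" and t: "t \<in> top_part"
  shows "conj_by (1 + a) t = t"
  using aug_mult_top[OF aug_odd[OF a] t] by (simp add: conj_by_odd_unit[OF a] algebra_simps)

lemma conj_by_alg_aut:
  fixes a :: "('k, 'n::{finite,linorder}) grassmann"
  assumes a: "a \<in> odd_part"
  shows "conj_by (1 + a) \<in> alg_aut"
proof -
  have inv: "(1 - a) * (1 + a) = 1" "(1 + a) * (1 - a) = 1"
    by (simp_all add: algebra_simps odd_square[OF a])
  \<comment> \<open>These rules delete adjacent inverse factors inside right-nested
    products.\<close>
  note cancel = inv[THEN arg_cong, of "\<lambda>x. x * _", unfolded mult.assoc mult_1_left]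
  have conj: "conj_by (1 + a) = (\<lambda>x. (1 + a) * (x * (1 - a)))"
    by (simp add: fun_eq_iff conj_by_odd_unit[OF a] mult.assoc)
  have "bij (conj_by (1 + a))"
  proof (rule o_bij)
    show "(\<lambda>x. (1 - a) * (x * (1 + a))) \<circ> conj_by (1 + a) = id"
      "conj_by (1 + a) \<circ> (\<lambda>x. (1 - a) * (x * (1 + a))) = id"
      unfolding conj fun_eq_iff comp_apply id_apply mult.assoc
      by (simp_all only: cancel inv mult_1_right simp_thms)
  qed
  moreover have "conj_by (1 + a) (x + y) = conj_by (1 + a) x + conj_by (1 + a) y" for x y
    by (simp only: conj distrib_right[of x y] distrib_left)
  moreover have "conj_by (1 + a) (x * y) = conj_by (1 + a) x * conj_by (1 + a) y" for x y
    by (simp only: conj mult.assoc cancel)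
  moreover have "conj_by (1 + a) 1 = 1" by (simp only: conj mult_1_left inv)
  moreover have "conj_by (1 + a) (c *g x) = c *g conj_by (1 + a) x" for c x
    by (simp only: conj gscale_simps)
  ultimately show ?thesis by (simp add: alg_aut_def)
qed

text \<open>The displacement of \<open>gvar i\<close> by the inner conjugation is even, hence fixed
  by the outer one, so displacements add. The group laws of \<open>\<Omega>\<close> reduce to
  addition in \<open>odd_part\<close>.\<close>

lemma conj_by_comp:
  fixes a b :: "('k, 'n::{finite,linorder}) grassmann"
  assumes a: "a \<in> odd_part" and b: "b \<in> odd_part"
  shows "conj_by (1 + a) \<circ> conj_by (1 + b) = conj_by (1 + (a + b))"
proof (rule alg_aut_eqI)
  have ab: "a + b \<in> odd_part" using a b unfolding odd_part_def by (rule graded_part_add)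
  show "conj_by (1 + a) \<circ> conj_by (1 + b) \<in> alg_aut" "conj_by (1 + (a + b)) \<in> alg_aut"
    by (intro alg_aut_comp conj_by_alg_aut a b ab)+
  fix i
  have "conj_by (1 + a) (b * gvar i) = b * gvar i"
    by (intro conj_by_even a odd_mult_odd b gvar_odd)
  then show "(conj_by (1 + a) \<circ> conj_by (1 + b)) (gvar i) = conj_by (1 + (a + b)) (gvar i)"
    by (simp add: conj_by_odd a b ab gvar_odd alg_aut_simps[OF conj_by_alg_aut[OF a]] algebra_simps)
qed

lemma conj_by_U_set:
  fixes a :: "('k, 'n::{finite,linorder}) grassmann"
  assumes a: "a \<in> odd_part"
  shows "conj_by (1 + a) \<in> U_set"
proof -
  have "conj_by (1 + a) (gvar i) - gvar i \<in> ideal_power \<mm> 2" for i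
  proof -
    have "a * gvar i \<in> graded_part {2..}"
      by (rule graded_part_mult[OF aug_odd[OF a, unfolded aug_ideal_def] gvar_graded_part[of "{1..}"]]) auto
    then show ?thesis by (simp add: conj_by_odd[OF a gvar_odd] ideal_power_aug graded_part_add)
  qed
  then show ?thesis by (simp add: U_set_def conj_by_alg_aut[OF a])
qed

lemma OmegaE:
  fixes \<sigma> :: "('k, 'n::{finite,linorder}) grassmann \<Rightarrow> _"
  assumes "\<sigma> \<in> \<Omega>"
  obtains a where "\<sigma> = conj_by (1 + a)" "a \<in> odd_part"
  using assms by (auto simp: Omega_def)

lemma OmegaI:
  fixes a :: "('k, 'n::{finite,linorder}) grassmann"
  shows "a \<in> odd_part \<Longrightarrow> conj_by (1 + a) \<in> \<Omega>"
  by (auto simp: Omega_def)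

lemma conj_by_inverse:
  fixes a :: "('k, 'n::{finite,linorder}) grassmann"
  assumes a: "a \<in> odd_part"
  shows "conj_by (1 + a) \<circ> conj_by (1 + - a) = id" "conj_by (1 + - a) \<circ> conj_by (1 + a) = id"
proof -
  have "- a \<in> odd_part" using a unfolding odd_part_def by (rule graded_part_uminus)
  moreover have "conj_by (1 + 0) = (id :: ('k, 'n) grassmann \<Rightarrow> _)"
    using conj_by_odd_unit[of "0 :: ('k, 'n) grassmann"]
    by (simp add: fun_eq_iff odd_part_def graded_part_zero)
  ultimately show "conj_by (1 + a) \<circ> conj_by (1 + - a) = id" "conj_by (1 + - a) \<circ> conj_by (1 + a) = id"
    using conj_by_comp[of a "- a"] conj_by_comp[of "- a" a] a by simp_all
qed

lemma subgroup_Omega: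
  "subgroup (\<Omega> :: (('k, 'n::{finite,linorder}) grassmann \<Rightarrow> _) set) U_group"
proof (rule group.subgroupI[OF group_U_group])
  show "\<Omega> \<subseteq> carrier (U_group :: (('k, 'n) grassmann \<Rightarrow> _) monoid)"
    by (auto elim!: OmegaE simp: conj_by_U_set)
  have "(0 :: ('k, 'n) grassmann) \<in> odd_part" unfolding odd_part_def by (rule graded_part_zero)
  then show "(\<Omega> :: (('k, 'n) grassmann \<Rightarrow> _) set) \<noteq> {}" using OmegaI by blast
next
  fix \<sigma> \<tau> :: "('k, 'n) grassmann \<Rightarrow> ('k, 'n) grassmann"
  assume "\<sigma> \<in> \<Omega>" "\<tau> \<in> \<Omega>"
  then obtain a b where ab: "\<sigma> = conj_by (1 + a)" "a \<in> odd_part" "\<tau> = conj_by (1 + b)" "b \<in> odd_part"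
    by (metis OmegaE)
  have "a + b \<in> odd_part" using ab(2,4) unfolding odd_part_def by (rule graded_part_add)
  then show "\<sigma> \<otimes>\<^bsub>U_group\<^esub> \<tau> \<in> \<Omega>" using ab by (simp add: conj_by_comp OmegaI)
next
  fix \<sigma> :: "('k, 'n) grassmann \<Rightarrow> ('k, 'n) grassmann"
  assume "\<sigma> \<in> \<Omega>"
  then obtain a where a: "\<sigma> = conj_by (1 + a)" "a \<in> odd_part" by (rule OmegaE)
  have neg: "- a \<in> odd_part" using a(2) unfolding odd_part_def by (rule graded_part_uminus)
  have "inv\<^bsub>U_group\<^esub> \<sigma> = conj_by (1 + - a)"
    unfolding a(1)
    by (rule group.inv_equality[OF group_U_group])
       (simp_all only: U_group_simps conj_by_inverse[OF a(2)] conj_by_U_set a(2) neg)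
  then show "inv\<^bsub>U_group\<^esub> \<sigma> \<in> \<Omega>" using OmegaI[OF neg] by simp
qed

lemma Omega_commute:
  fixes \<sigma> \<tau> :: "('k, 'n::{finite,linorder}) grassmann \<Rightarrow> _"
  assumes "\<sigma> \<in> \<Omega>" "\<tau> \<in> \<Omega>"
  shows "\<sigma> \<circ> \<tau> = \<tau> \<circ> \<sigma>"
proof -
  obtain a b where "\<sigma> = conj_by (1 + a)" "a \<in> odd_part" "\<tau> = conj_by (1 + b)" "b \<in> odd_part"
    using assms by (metis OmegaE)
  then show ?thesis by (simp only: conj_by_comp add.commute[of b a])
qed

text \<open>Each automorphism fixes the displacement caused by the other: \<open>\<tau>\<close>
  fixes \<open>a * gvar i\<close>, of degree at least 2, and \<open>\<sigma>\<close> fixes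
  \<open>top_part\<close>.\<close>

lemma Omega_U_pow_top_commute:
  fixes \<sigma> \<tau> :: "('k, 'n::{finite,linorder}) grassmann \<Rightarrow> _"
  assumes "\<sigma> \<in> \<Omega>" and \<tau>: "\<tau> \<in> U_pow CARD('n)"
  shows "\<sigma> \<circ> \<tau> = \<tau> \<circ> \<sigma>"
proof -
  obtain a where \<sigma>: "\<sigma> = conj_by (1 + a)" and a: "a \<in> odd_part" using assms(1) by (rule OmegaE)
  have aut: "\<tau> \<in> alg_aut" "\<sigma> \<in> alg_aut"
    using \<tau> \<sigma> conj_by_alg_aut[OF a] by (auto simp: U_pow_def U_set_def)
  note hom = alg_aut_simps[OF aut(1)] alg_aut_simps[OF aut(2)]
  show ?thesis
  proof (rule alg_aut_eqI)
    show "\<sigma> \<circ> \<tau> \<in> alg_aut" "\<tau> \<circ> \<sigma> \<in> alg_aut" using aut by (simp_all add: alg_aut_comp)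
    fix i
    have "\<tau> (gvar i) - gvar i \<in> top_part" using \<tau> by (simp add: U_pow_top_iff)
    then have "\<sigma> (\<tau> (gvar i) - gvar i) = \<tau> (gvar i) - gvar i"
      unfolding \<sigma> by (rule conj_by_top[OF a])
    moreover have "a * gvar i \<in> graded_part {2..}"
      by (rule graded_part_mult[OF aug_odd[OF a, unfolded aug_ideal_def] gvar_graded_part[of "{1..}"]]) auto
    then have "\<tau> (a * gvar i) = a * gvar i" by (rule U_pow_top_fixes_square[OF \<tau>])
    moreover have "\<sigma> (gvar i) = gvar i + (a * gvar i + a * gvar i)"
      unfolding \<sigma> by (rule conj_by_odd[OF a gvar_odd])
    ultimately show "(\<sigma> \<circ> \<tau>) (gvar i) = (\<tau> \<circ> \<sigma>) (gvar i)"
      \<comment> \<open>The list \<open>hom\<close> has seven rules for \<open>\<tau>\<close>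
        followed by seven for \<open>\<sigma>\<close>, so \<open>hom(14)\<close> is the subtraction
        rule for \<open>\<sigma>\<close>.\<close>
      using hom(1)[of "gvar i" "a * gvar i + a * gvar i"] hom(1)[of "a * gvar i" "a * gvar i"]
      by (simp add: hom(14) algebra_simps)
  qed
qed

section \<open>The centralizer of \<open>\<Omega>\<close>\<close>

text \<open>Exactness gives \<open>e i = a * gvar i\<close>. Conjugation by \<open>1 + b\<close>
  displaces \<open>gvar i\<close> by twice \<open>b * gvar i\<close>, so half of \<open>a\<close> is
  the right parameter.\<close>

lemma koszul_conj:
  fixes e :: "'n::{finite,linorder} \<Rightarrow> ('k, 'n) grassmann"
  assumes rel: "\<And>i j. e i * gvar j + e j * gvar i = 0" and even: "\<And>i. e i \<in> even_part"
  obtains a where "a \<in> odd_part" "\<And>i. conj_by (1 + a) (gvar i) = gvar i + e i"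
proof -
  obtain h :: 'k where h: "2 * h = 1" using half by blast
  \<comment> \<open>The diagonal relation is twice the desired one.\<close>
  have sq: "e i * gvar i = 0" for i using rel[of i i] by (rule add_self_eq_zero)
  obtain a where a: "a \<in> odd_part" "\<And>i. e i = a * gvar i"
    by (rule koszul_exact[OF rel sq even]) (rule that)
  have h': "h *g a \<in> odd_part" using a(1) unfolding odd_part_def by (rule graded_part_scale)
  have "h *g b + h *g b = b" for b :: "('k, 'n) grassmann"
  proof -
    have "h *g b + h *g b = (2 * h) *g b" by (simp only: gscale_simps(2)[symmetric] mult_2)
    then show ?thesis by (simp add: h gscale_simps)
  qed
  then have "conj_by (1 + h *g a) (gvar i) = gvar i + e i" for i
    by (simp add: conj_by_odd[OF h' gvar_odd] a(2) gscale_simps)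
  with h' show thesis by (rule that)
qed

text \<open>Write \<open>\<sigma> x\<^sub>j = e\<^sub>j + p\<^sub>j\<close> with \<open>e\<^sub>j\<close> even and \<open>p\<^sub>j\<close> odd. Since \<open>\<sigma>\<close> commutes with
  \<open>\<omega>\<^bsub>1 + x\<^sub>j\<^esub>\<close>, that automorphism is also conjugation by \<open>1 + \<sigma> x\<^sub>j\<close>; this gives
  \<open>(p\<^sub>j - x\<^sub>j) x\<^sub>i = 0\<close> for all \<open>i\<close>, so \<open>p\<^sub>j - x\<^sub>j\<close> has degree \<open>n\<close>. The odd part of
  \<open>\<sigma> x\<^sub>i \<sigma> x\<^sub>j + \<sigma> x\<^sub>j \<sigma> x\<^sub>i = 0\<close> is then the Koszul relation for the \<open>e\<^sub>i\<close>.\<close>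

lemma centralizer_Omega:
  fixes \<sigma> :: "('k, 'n::{finite,linorder}) grassmann \<Rightarrow> _"
  assumes U: "\<sigma> \<in> U_set" and comm: "\<And>\<omega>. \<omega> \<in> \<Omega> \<Longrightarrow> \<sigma> \<circ> \<omega> = \<omega> \<circ> \<sigma>"
  obtains \<omega> \<tau> where "\<omega> \<in> \<Omega>" "\<tau> \<in> U_pow CARD('n)" "\<sigma> = \<omega> \<circ> \<tau>"
proof -
  have aut: "\<sigma> \<in> alg_aut" by (rule U_setD[OF U])
  note hom = alg_aut_simps[OF aut]
  have "\<exists>e p. \<sigma> (gvar i) = e + p \<and> e \<in> even_part \<and> p \<in> odd_part" for i
    by (metis even_odd_decomp)
  then obtain e p where ep: "\<And>i. \<sigma> (gvar i) = e i + p i" "\<And>i. e i \<in> even_part" "\<And>i. p i \<in> odd_part"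
    by metis
  have e_mult: "e i * x = x * e i" for i x by (rule even_commute[OF ep(2)])
  have ep_odd: "e i * p j \<in> odd_part" for i j by (rule even_mult_odd[OF ep(2,3)])
  have ee_even: "e i * e j \<in> even_part" for i j by (rule graded_part_mult[OF ep(2) ep(2)]) auto
  have odd_add: "a + b \<in> odd_part" if "a \<in> odd_part" "b \<in> odd_part" for a b :: "('k, 'n) grassmann"
    using that unfolding odd_part_def by (rule graded_part_add)
  \<comment> \<open>Elements of the augmentation ideal annihilate \<open>top_part\<close>; this
    later allows \<open>gvar j\<close> in place of \<open>p j\<close>.\<close>
  have aug_e: "e i \<in> \<mm>" for i
  proof -
    have "\<sigma> (gvar i) \<in> \<mm>" by (rule U_set_aug[OF U aug_odd[OF gvar_odd]])
    then have "\<sigma> (gvar i) - p i \<in> \<mm>"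
      using aug_odd[OF ep(3)] unfolding aug_ideal_def by (rule graded_part_diff)
    then show ?thesis by (simp add: ep(1))
  qed
  have anti: "(e i + p i) * (e j + p j) + (e j + p j) * (e i + p i) = 0" for i j
  proof -
    have "gvar i * gvar j + gvar j * gvar i = (0 :: ('k, 'n) grassmann)"
      by (rule iffD1[OF eq_neg_iff_add_eq_0], rule odd_anticommute[OF gvar_odd gvar_odd])
    then have "\<sigma> (gvar i * gvar j + gvar j * gvar i) = 0" by (simp only: hom(5))
    then show ?thesis by (simp only: hom(1,2) ep(1))
  qed
  have rel_ep: "e i * p j + e j * p i = 0" and ee: "e i * e j = 0" for i j
  proof -
    have pp: "p i * p j + p j * p i = 0"
      by (rule iffD1[OF eq_neg_iff_add_eq_0], rule odd_anticommute[OF ep(3) ep(3)])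
    \<comment> \<open>Graded commutativity leaves twice \<open>e i * e j\<close>, which is even,
      plus twice \<open>e i * p j + e j * p i\<close>, which is odd; the two parts vanish
      separately.\<close>
    have "(e i + p i) * (e j + p j) + (e j + p j) * (e i + p i) =
        (e i * e j + e j * e i) + ((e i * p j + e j * p i) + (p i * e j + p j * e i)) + (p i * p j + p j * p i)"
      by (simp only: distrib_left distrib_right add.assoc add.left_commute add.commute)
    also have "\<dots> = (e i * e j + e i * e j) + ((e i * p j + e j * p i) + (e i * p j + e j * p i))"
      by (simp only: pp e_mult[of j "e i"] e_mult[of i "p j", symmetric] e_mult[of j "p i", symmetric]
          add_0_left add_0_right add.commute)
    finally have sum: "(e i * e j + e i * e j) + ((e i * p j + e j * p i) + (e i * p j + e j * p i)) = 0"
      using anti by simp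
    have ev: "e i * e j + e i * e j \<in> even_part" by (intro graded_part_add ee_even)
    have od: "(e i * p j + e j * p i) + (e i * p j + e j * p i) \<in> odd_part" by (intro odd_add ep_odd)
    show "e i * p j + e j * p i = 0" "e i * e j = 0"
      using even_odd_zero[OF ev od sum] by (auto intro: add_self_eq_zero)
  qed
  have top: "p j - gvar j \<in> top_part" for j
  proof (rule gvar_annihilator)
    fix i
    let ?\<omega> = "conj_by (1 + gvar j) :: ('k, 'n) grassmann \<Rightarrow> _" and ?x = "gvar i :: ('k, 'n) grassmann"
    \<comment> \<open>A preimage of the generator lets \<open>?\<omega> ?x\<close> be computed
      through \<open>\<sigma>\<close>, which turns \<open>gvar j\<close> into
      \<open>e j + p j\<close>.\<close>
    obtain z where z: "\<sigma> z = ?x" using aut by (metis (mono_tags, lifting) alg_aut_def bij_is_surj mem_Collect_eq surjD)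
    have "?x + (gvar j * ?x + gvar j * ?x) = ?\<omega> ?x"
      by (rule conj_by_odd[OF gvar_odd gvar_odd, symmetric])
    also have "\<dots> = \<sigma> (?\<omega> z)"
      using fun_cong[OF comm[OF OmegaI[OF gvar_odd]], of j z] by (simp only: comp_apply z)
    also have "\<dots> = (1 + (e j + p j)) * ?x * (1 - (e j + p j))"
      by (simp only: conj_by_odd_unit[OF gvar_odd] hom z ep(1))
    also have "\<dots> = ?x + (e j * ?x - ?x * e j) + (p j * ?x - ?x * p j)
        - (e j * ?x * e j + e j * ?x * p j + p j * ?x * e j + p j * ?x * p j)"
      by (simp add: algebra_simps)
    \<comment> \<open>The zeros come from \<open>e j\<close> being central and from the squares of
      \<open>e j\<close> and \<open>p j\<close> vanishing; the two mixed cubic terms cancel each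
      other.\<close>
    also have "\<dots> = ?x + 0 + (p j * ?x - - (p j * ?x)) - (0 + - (e j * (p j * ?x)) + e j * (p j * ?x) + 0)"
    proof -
      have xp: "?x * p j = - (p j * ?x)" by (rule odd_anticommute[OF gvar_odd ep(3)])
      have "e j * ?x - ?x * e j = 0" by (simp add: e_mult)
      moreover have "e j * ?x * e j = 0" by (metis e_mult ee mult.assoc mult_zero_left)
      moreover have "e j * ?x * p j = - (e j * (p j * ?x))" by (simp only: mult.assoc xp mult_minus_right)
      moreover have "p j * ?x * e j = e j * (p j * ?x)" by (simp only: e_mult)
      moreover have "p j * ?x * p j = - (p j * p j * ?x)" by (simp only: mult.assoc xp mult_minus_right)
      ultimately show ?thesis by (simp only: xp odd_square[OF ep(3)] mult_zero_left minus_zero)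
    qed
    finally have "(p j - gvar j) * ?x + (p j - gvar j) * ?x = 0" by (simp add: algebra_simps)
    then show "(p j - gvar j) * ?x = 0" by (rule add_self_eq_zero)
  qed
  have rel: "e i * gvar j + e j * gvar i = 0" for i j
  proof -
    have "e i * (p j - gvar j) = 0" for i j by (rule aug_mult_top(1)[OF aug_e top])
    then have "e i * p j = e i * gvar j" for i j by (simp add: right_diff_distrib)
    then show ?thesis using rel_ep[of i j] by simp
  qed
  obtain a where a: "a \<in> odd_part" "\<And>i. conj_by (1 + a) (gvar i) = gvar i + e i"
    by (rule koszul_conj[OF rel ep(2)]) (rule that)
  have na: "- a \<in> odd_part" using a(1) unfolding odd_part_def by (rule graded_part_uminus)
  \<comment> \<open>Undoing the conjugation leaves the displacement \<open>p i - gvar i\<close>,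
    which has top degree and is fixed by \<open>conj_by (1 + - a)\<close>.\<close>
  let ?\<tau> = "conj_by (1 + - a) \<circ> \<sigma>"
  have "?\<tau> (gvar i) - gvar i \<in> top_part" for i
  proof -
    note hom' = alg_aut_simps[OF conj_by_alg_aut[OF na]]
    have "\<sigma> (gvar i) = conj_by (1 + a) (gvar i) + (p i - gvar i)" by (simp add: ep(1) a(2))
    then have "?\<tau> (gvar i) = (conj_by (1 + - a) \<circ> conj_by (1 + a)) (gvar i) + conj_by (1 + - a) (p i - gvar i)"
      by (simp only: comp_apply hom'(1))
    also have "\<dots> = gvar i + (p i - gvar i)"
      by (simp only: conj_by_inverse[OF a(1)] conj_by_top[OF na top] id_apply)
    finally show ?thesis using top by simp
  qed
  moreover have "?\<tau> \<in> U_set"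
    using monoid.m_closed[OF group.is_monoid[OF group_U_group], of "conj_by (1 + - a)" \<sigma>]
      conj_by_U_set[OF na] U by simp
  ultimately have "?\<tau> \<in> U_pow CARD('n)" by (simp only: U_pow_top_iff simp_thms)
  moreover have "\<sigma> = conj_by (1 + a) \<circ> ?\<tau>"
    by (simp only: comp_assoc[symmetric] conj_by_inverse[OF a(1)] id_comp)
  ultimately show thesis using that OmegaI[OF a(1)] by blast
qed

section \<open>Comparison of \<open>\<Omega>\<close> with the top-degree subgroup\<close>

text \<open>For even n the displacements are even and annihilated by every generator, so the Koszul
  relations hold trivially.\<close>

lemma U_pow_top_subset_Omega:
  assumes n: "even CARD('n::{finite,linorder})"
  shows "U_pow CARD('n) \<subseteq> (\<Omega> :: (('k, 'n) grassmann \<Rightarrow> _) set)"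
proof
  fix \<sigma> :: "('k, 'n) grassmann \<Rightarrow> ('k, 'n) grassmann"
  assume \<sigma>: "\<sigma> \<in> U_pow CARD('n)"
  have top: "\<sigma> (gvar i) - gvar i \<in> top_part" for i using \<sigma> by (simp add: U_pow_top_iff)
  have zero: "(\<sigma> (gvar i) - gvar i) * gvar j = 0" for i j
    by (rule aug_mult_top(2)[OF aug_odd[OF gvar_odd] top])
  have even: "\<sigma> (gvar i) - gvar i \<in> even_part" for i
    using top[of i] unfolding top_part_eq by (rule graded_part_mono[rotated]) (simp add: n)
  obtain a where a: "a \<in> odd_part" "\<And>i. conj_by (1 + a) (gvar i) = gvar i + (\<sigma> (gvar i) - gvar i)"
    by (rule koszul_conj[of "\<lambda>i. \<sigma> (gvar i) - gvar i"]) (simp only: zero add_0_left, rule even, rule that)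
  have "\<sigma> = conj_by (1 + a)"
    by (rule alg_aut_eqI) (use \<sigma> a in \<open>auto simp: conj_by_alg_aut U_pow_def U_set_def\<close>)
  then show "\<sigma> \<in> \<Omega>" using OmegaI[OF a(1)] by simp
qed

text \<open>The displacement of a generator is twice \<open>a * gvar i\<close>, which is even, and
  also lies in the odd degree n; hence it is zero.\<close>

lemma Omega_Int_U_pow_top:
  assumes n: "odd CARD('n::{finite,linorder})" "CARD('n) \<ge> 2"
  shows "\<Omega> \<inter> U_pow CARD('n) = {id :: ('k, 'n) grassmann \<Rightarrow> _}"
proof -
  have "\<sigma> = id" if \<sigma>: "\<sigma> \<in> \<Omega>" "\<sigma> \<in> U_pow CARD('n)" for \<sigma> :: "('k, 'n) grassmann \<Rightarrow> _"
  proof (rule alg_aut_eqI)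
    obtain a where a: "\<sigma> = conj_by (1 + a)" "a \<in> odd_part" using \<sigma>(1) by (rule OmegaE)
    show "\<sigma> \<in> alg_aut" "id \<in> (alg_aut :: (('k, 'n) grassmann \<Rightarrow> _) set)"
      using conj_by_alg_aut[OF a(2)] by (simp_all add: a(1)) (simp add: alg_aut_def)
    fix i
    have eq: "\<sigma> (gvar i) = gvar i + (a * gvar i + a * gvar i)"
      unfolding a(1) by (rule conj_by_odd[OF a(2) gvar_odd])
    have "a * gvar i + a * gvar i \<in> even_part"
      by (intro graded_part_add odd_mult_odd a(2) gvar_odd)
    moreover have "\<sigma> (gvar i) - gvar i \<in> top_part" using \<sigma>(2) by (simp add: U_pow_top_iff)
    then have "\<sigma> (gvar i) - gvar i \<in> odd_part"
      unfolding top_part_eq odd_part_def by (rule graded_part_mono[rotated]) (simp add: n(1))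
    then have "a * gvar i + a * gvar i \<in> odd_part" by (simp add: eq)
    ultimately have "a * gvar i + a * gvar i = 0"
      unfolding odd_part_def by (rule graded_part_disjoint) auto
    then show "\<sigma> (gvar i) = id (gvar i)" by (simp add: eq)
  qed
  moreover have "id \<in> (\<Omega> :: (('k, 'n) grassmann \<Rightarrow> _) set)"
    "id \<in> (U_pow CARD('n) :: (('k, 'n) grassmann \<Rightarrow> _) set)"
    using subgroup.one_closed[OF subgroup_Omega] subgroup.one_closed[OF subgroup_U_pow_top[OF n(2)]]
    by simp_all
  ultimately show ?thesis by blast
qed

end

theorem theorem2p17:
  assumes reduced: "\<forall>(c::'k::comm_ring_1) m. c ^ m = 0 \<longrightarrow> c = 0"
    and half: "\<exists>h::'k. 2 * h = 1"
    and n: "CARD('n::{finite,linorder}) \<ge> 2"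
  shows "(even CARD('n) \<longrightarrow>
      maximal_abelian_subgroup \<Omega> (U_group :: (('k, 'n) grassmann \<Rightarrow> ('k, 'n) grassmann) monoid) \<and>
      U_pow CARD('n) \<subseteq> (\<Omega> :: (('k, 'n) grassmann \<Rightarrow> ('k, 'n) grassmann) set)) \<and>
    (odd CARD('n) \<longrightarrow>
      maximal_abelian_subgroup (\<Omega> <#>\<^bsub>U_group\<^esub> U_pow CARD('n))
        (U_group :: (('k, 'n) grassmann \<Rightarrow> ('k, 'n) grassmann) monoid) \<and>
      internal_direct_product \<Omega> (U_pow CARD('n))
        (U_group :: (('k, 'n) grassmann \<Rightarrow> ('k, 'n) grassmann) monoid) \<and>
      \<Omega> \<inter> U_pow CARD('n) = {id :: ('k, 'n) grassmann \<Rightarrow> ('k, 'n) grassmann})"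
proof -
  note \<Omega> = subgroup_Omega[OF half, where 'n = 'n] and L = subgroup_U_pow_top[OF n, where 'k = 'k]
  have comm: "\<omega> \<otimes>\<^bsub>U_group\<^esub> \<tau> = \<tau> \<otimes>\<^bsub>U_group\<^esub> \<omega>"
    if "\<omega> \<in> \<Omega>" "\<tau> \<in> U_pow CARD('n)" for \<omega> \<tau> :: "('k, 'n) grassmann \<Rightarrow> ('k, 'n) grassmann"
    using Omega_U_pow_top_commute[OF half that] by simp
  have "maximal_abelian_subgroup \<Omega> (U_group :: (('k, 'n) grassmann \<Rightarrow> _) monoid)"
    "U_pow CARD('n) \<subseteq> (\<Omega> :: (('k, 'n) grassmann \<Rightarrow> _) set)" if even: "even CARD('n)"
  proof -
    show sub: "U_pow CARD('n) \<subseteq> (\<Omega> :: (('k, 'n) grassmann \<Rightarrow> _) set)"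
      by (rule U_pow_top_subset_Omega[OF half even])
    show "maximal_abelian_subgroup \<Omega> (U_group :: (('k, 'n) grassmann \<Rightarrow> _) monoid)"
    proof (rule group.maximal_abelian_subgroupI[OF group_U_group \<Omega>])
      fix \<sigma> :: "('k, 'n) grassmann \<Rightarrow> ('k, 'n) grassmann"
      assume "\<sigma> \<in> carrier U_group" "\<And>\<omega>. \<omega> \<in> \<Omega> \<Longrightarrow> \<sigma> \<otimes>\<^bsub>U_group\<^esub> \<omega> = \<omega> \<otimes>\<^bsub>U_group\<^esub> \<sigma>"
      then obtain \<omega> \<tau> where "\<omega> \<in> \<Omega>" "\<tau> \<in> U_pow CARD('n)" "\<sigma> = \<omega> \<circ> \<tau>"
        using centralizer_Omega[OF half, of \<sigma>] by auto
      \<comment> \<open>By \<open>sub\<close> the top-degree factor \<open>\<tau>\<close> is itself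
        in \<open>\<Omega>\<close>.\<close>
      then show "\<sigma> \<in> \<Omega>" using sub subgroup.m_closed[OF \<Omega>, of \<omega> \<tau>] by auto
    qed (simp add: Omega_commute[OF half])
  qed
  moreover have "maximal_abelian_subgroup (\<Omega> <#>\<^bsub>U_group\<^esub> U_pow CARD('n))
      (U_group :: (('k, 'n) grassmann \<Rightarrow> _) monoid)"
  proof (rule group.maximal_abelian_subgroupI[OF group_U_group group.subgroup_set_mult[OF group_U_group \<Omega> L comm]])
    fix \<sigma> \<sigma>' :: "('k, 'n) grassmann \<Rightarrow> ('k, 'n) grassmann"
    assume "\<sigma> \<in> \<Omega> <#>\<^bsub>U_group\<^esub> U_pow CARD('n)" "\<sigma>' \<in> \<Omega> <#>\<^bsub>U_group\<^esub> U_pow CARD('n)"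
    then obtain \<omega> \<tau> \<omega>' \<tau>' where *: "\<sigma> = \<omega> \<circ> \<tau>" "\<sigma>' = \<omega>' \<circ> \<tau>'" "\<omega> \<in> \<Omega>" "\<omega>' \<in> \<Omega>"
      "\<tau> \<in> U_pow CARD('n)" "\<tau>' \<in> U_pow CARD('n)" by (auto simp: set_mult_def)
    note c = Omega_commute[OF half *(3,4)] U_pow_top_commute[OF n *(5,6)]
      Omega_U_pow_top_commute[OF half *(3,6)] Omega_U_pow_top_commute[OF half *(4,5)]
    have "\<sigma> \<circ> \<sigma>' = \<omega> \<circ> (\<tau> \<circ> \<omega>') \<circ> \<tau>'" by (simp only: * comp_assoc)
    also have "\<dots> = (\<omega> \<circ> \<omega>') \<circ> (\<tau> \<circ> \<tau>')" by (simp only: c(4)[symmetric] comp_assoc)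
    also have "\<dots> = \<omega>' \<circ> (\<omega> \<circ> \<tau>') \<circ> \<tau>" by (simp only: c(1,2) comp_assoc)
    also have "\<dots> = \<sigma>' \<circ> \<sigma>" by (simp only: c(3) * comp_assoc)
    finally show "\<sigma> \<otimes>\<^bsub>U_group\<^esub> \<sigma>' = \<sigma>' \<otimes>\<^bsub>U_group\<^esub> \<sigma>" by simp
  next
    fix \<sigma> :: "('k, 'n) grassmann \<Rightarrow> ('k, 'n) grassmann"
    assume \<sigma>: "\<sigma> \<in> carrier U_group"
      "\<And>\<omega>. \<omega> \<in> \<Omega> <#>\<^bsub>U_group\<^esub> U_pow CARD('n) \<Longrightarrow> \<sigma> \<otimes>\<^bsub>U_group\<^esub> \<omega> = \<omega> \<otimes>\<^bsub>U_group\<^esub> \<sigma>"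
    \<comment> \<open>Since \<open>\<Omega>\<close> sits in the product set with second factor
      \<open>id\<close>, centralizing the product set implies centralizing \<open>\<Omega>\<close>,
      as \<open>centralizer_Omega\<close> requires.\<close>
    have sub: "\<omega> \<in> \<Omega> <#>\<^bsub>U_group\<^esub> U_pow CARD('n)" if "\<omega> \<in> \<Omega>" for \<omega> :: "('k, 'n) grassmann \<Rightarrow> _"
    proof -
      have "\<omega> = \<omega> \<circ> id" "id \<in> (U_pow CARD('n) :: (('k, 'n) grassmann \<Rightarrow> _) set)"
        using subgroup.one_closed[OF L] by simp_all
      then show ?thesis unfolding set_mult_def U_group_simps using that by blast
    qed
    have "\<sigma> \<in> U_set" "\<And>\<omega>. \<omega> \<in> \<Omega> \<Longrightarrow> \<sigma> \<circ> \<omega> = \<omega> \<circ> \<sigma>"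
      using \<sigma>(1) \<sigma>(2)[OF sub] by simp_all
    from centralizer_Omega[OF half this] obtain \<omega> \<tau>
      where "\<omega> \<in> \<Omega>" "\<tau> \<in> U_pow CARD('n)" "\<sigma> = \<omega> \<circ> \<tau>" .
    then show "\<sigma> \<in> \<Omega> <#>\<^bsub>U_group\<^esub> U_pow CARD('n)" by (auto simp: set_mult_def)
  qed
  moreover have "\<Omega> \<inter> U_pow CARD('n) = {id :: ('k, 'n) grassmann \<Rightarrow> _}" if "odd CARD('n)"
    by (rule Omega_Int_U_pow_top[OF half that n])
  moreover from this have "internal_direct_product \<Omega> (U_pow CARD('n))
      (U_group :: (('k, 'n) grassmann \<Rightarrow> _) monoid)" if "odd CARD('n)"
    using that by (intro group.internal_direct_productI[OF group_U_group \<Omega> L comm]) simp_all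
  ultimately show ?thesis by blast
qed

end
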